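(* Let $0<\lambda\leq 1$ and let $A$ and $B$ be invertible positive operators on a Hilbert space. (1) $T_{\lambda}(A\vert B)\leq H_{\lambda}(A)+(\ln_{\lambda}\Vert B\Vert)\,A^{1-\lambda}$. (2) If $\mu>0$ is a real number with $\mu A\leq B$, then $T_{\lambda}(A\vert B)\geq(\ln_{\lambda}\mu)A$.
   Context: Operators are bounded linear operators on a (nonzero) Hilbert space, $X\leq Y$ means that $Y-X$ is positive (semidefinite), and $\Vert B\Vert$ is the operator norm. For invertible positive operators $A,B$ and $\lambda\in(0,1]$, the Tsallis relative operator entropy is $T_{\lambda}(A\vert B):=\frac{1}{\lambda}\left(A^{1/2}(A^{-1/2}BA^{-1/2})^{\lambda}A^{1/2}-A\right)$, and the Tsallis operator entropy is $H_{\lambda}(A):=T_{\lambda}(A\vert I)=\frac{A^{1-\lambda}-A}{\lambda}$. For a real number $x>0$, $\ln_{\lambda}x:=\frac{x^{\lambda}-1}{\lambda}$. *)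

theory Defs
  imports "HOL-Analysis.Analysis" "HOL-Computational_Algebra.Polynomial"
begin

text \<open>The inner product is linear in its first argument. The norm, the metric and the
  completeness are those of the underlying real Hilbert space, whose inner product is the real part
  of the complex one.\<close>

class complex_hilbert_space = real_inner + banach +
  fixes scaleC :: "complex \<Rightarrow> 'a \<Rightarrow> 'a" (infixr "*\<^sub>C" 75)
    and cinner :: "'a \<Rightarrow> 'a \<Rightarrow> complex"
  assumes scaleC_add_right: "c *\<^sub>C (x + y) = c *\<^sub>C x + c *\<^sub>C y"
    and scaleC_add_left: "(c + d) *\<^sub>C x = c *\<^sub>C x + d *\<^sub>C x"
    and scaleC_scaleC: "c *\<^sub>C (d *\<^sub>C x) = (c * d) *\<^sub>C x"
    and scaleR_scaleC: "r *\<^sub>R x = complex_of_real r *\<^sub>C x"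
    and cinner_add_left: "cinner (x + y) z = cinner x z + cinner y z"
    and cinner_scaleC_left: "cinner (c *\<^sub>C x) y = c * cinner x y"
    and cinner_commute: "cinner x y = cnj (cinner y x)"
    and inner_eq_Re_cinner: "inner x y = Re (cinner x y)"

instantiation complex :: complex_hilbert_space
begin

definition scaleC_complex :: "complex \<Rightarrow> complex \<Rightarrow> complex"
  where "scaleC_complex c x = c * x"

definition cinner_complex :: "complex \<Rightarrow> complex \<Rightarrow> complex"
  where "cinner_complex x y = x * cnj y"

instance
  by standard
    (auto simp: scaleC_complex_def cinner_complex_def inner_complex_def scaleR_conv_of_real
      algebra_simps)

end

text \<open>Operators are elements of \<^typ>\<open>'a \<Rightarrow>\<^sub>L 'a\<close> that are complex linear; the library type only
  provides real linearity. The norm of this type is the operator norm.\<close>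

definition complex_linear :: "('a::complex_hilbert_space \<Rightarrow>\<^sub>L 'a) \<Rightarrow> bool"
  where "complex_linear A \<longleftrightarrow>
    (\<forall>c x. blinfun_apply A (c *\<^sub>C x) = c *\<^sub>C blinfun_apply A x)"

text \<open>Over the complex numbers this condition implies self-adjointness.\<close>

definition positive_op :: "('a::complex_hilbert_space \<Rightarrow>\<^sub>L 'a) \<Rightarrow> bool"
  where "positive_op A \<longleftrightarrow>
    complex_linear A \<and> (\<forall>x. cinner (blinfun_apply A x) x \<in> \<real>\<^sub>\<ge>\<^sub>0)"

definition op_le :: "('a::complex_hilbert_space \<Rightarrow>\<^sub>L 'a) \<Rightarrow> ('a \<Rightarrow>\<^sub>L 'a) \<Rightarrow> bool"
    (infix "\<le>\<^sub>o\<^sub>p" 50)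
  where "X \<le>\<^sub>o\<^sub>p Y \<longleftrightarrow> positive_op (Y - X)"

text \<open>The inverse of a complex linear operator is automatically complex linear.\<close>

definition invertible_op :: "('a::real_normed_vector \<Rightarrow>\<^sub>L 'a) \<Rightarrow> bool"
  where "invertible_op A \<longleftrightarrow> (\<exists>C. A o\<^sub>L C = id_blinfun \<and> C o\<^sub>L A = id_blinfun)"

lift_definition scaleC_id :: "complex \<Rightarrow> 'a::complex_hilbert_space \<Rightarrow>\<^sub>L 'a" is "\<lambda>c x. c *\<^sub>C x"
proof -
  fix c :: complex
  show "bounded_linear (\<lambda>x::'a. c *\<^sub>C x)"
  proof (rule bounded_linear_intro)
    show "c *\<^sub>C (x + y) = c *\<^sub>C x + c *\<^sub>C y" for x y :: 'a
      by (rule scaleC_add_right)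
    show "c *\<^sub>C (r *\<^sub>R x) = r *\<^sub>R (c *\<^sub>C x)" for r and x :: 'a
      by (simp add: scaleR_scaleC scaleC_scaleC mult.commute)
    show "norm (c *\<^sub>C x) \<le> norm x * cmod c" for x :: 'a
    proof -
      have "cinner (c *\<^sub>C x) (c *\<^sub>C x) = c * cnj c * cinner x x"
        by (metis cinner_scaleC_left cinner_commute complex_cnj_mult mult.assoc mult.left_commute)
      then have "inner (c *\<^sub>C x) (c *\<^sub>C x) = (cmod c)\<^sup>2 * inner x x"
        by (simp add: inner_eq_Re_cinner complex_norm_square [symmetric])
      then show ?thesis
        by (simp add: norm_eq_sqrt_inner real_sqrt_mult)
    qed
  qed
qed

definition spectrum :: "('a::complex_hilbert_space \<Rightarrow>\<^sub>L 'a) \<Rightarrow> complex set"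
  where "spectrum A = {z. \<not> invertible_op (A - scaleC_id z)}"

definition op_poly :: "real poly \<Rightarrow> ('a::real_normed_vector \<Rightarrow>\<^sub>L 'a) \<Rightarrow> 'a \<Rightarrow>\<^sub>L 'a"
  where "op_poly p A =
    (\<Sum>i\<le>degree p. coeff p i *\<^sub>R (((\<lambda>X. A o\<^sub>L X) ^^ i) id_blinfun))"

text \<open>Continuous functional calculus \<open>f(A)\<close> for a self-adjoint operator \<open>A\<close>, whose spectrum is
  contained in the real line, and a real function \<open>f\<close> that is continuous on the spectrum: it is
  the norm limit of \<open>p\<^sub>n(A)\<close> for any real polynomials \<open>p\<^sub>n\<close> that converge to \<open>f\<close> uniformly on the
  spectrum. Outside this setting the value is not meaningful.\<close>

definition fun_calc :: "(real \<Rightarrow> real) \<Rightarrow> ('a::complex_hilbert_space \<Rightarrow>\<^sub>L 'a) \<Rightarrow> 'a \<Rightarrow>\<^sub>L 'a"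
  where "fun_calc f A =
    (THE T. \<forall>p. uniform_limit {t. complex_of_real t \<in> spectrum A} (\<lambda>n. poly (p n)) f sequentially
       \<longrightarrow> (\<lambda>n. op_poly (p n) A) \<longlonglongrightarrow> T)"

text \<open>Used only for invertible positive operators, whose spectrum lies in the open half-line of
  positive reals, where \<open>t powr r\<close> is continuous for every real \<open>r\<close>.\<close>

definition op_powr :: "('a::complex_hilbert_space \<Rightarrow>\<^sub>L 'a) \<Rightarrow> real \<Rightarrow> 'a \<Rightarrow>\<^sub>L 'a"
    (infixr "powr\<^sub>o\<^sub>p" 80)
  where "A powr\<^sub>o\<^sub>p r = fun_calc (\<lambda>t. t powr r) A"

definition tsallis_relative_entropy ::
    "real \<Rightarrow> ('a::complex_hilbert_space \<Rightarrow>\<^sub>L 'a) \<Rightarrow> ('a \<Rightarrow>\<^sub>L 'a) \<Rightarrow> 'a \<Rightarrow>\<^sub>L 'a"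
  where "tsallis_relative_entropy lam A B = (1 / lam) *\<^sub>R
    ((A powr\<^sub>o\<^sub>p (1/2) o\<^sub>L
      (A powr\<^sub>o\<^sub>p (-1/2) o\<^sub>L B o\<^sub>L A powr\<^sub>o\<^sub>p (-1/2)) powr\<^sub>o\<^sub>p lam o\<^sub>L
      A powr\<^sub>o\<^sub>p (1/2)) - A)"

definition tsallis_entropy ::
    "real \<Rightarrow> ('a::complex_hilbert_space \<Rightarrow>\<^sub>L 'a) \<Rightarrow> 'a \<Rightarrow>\<^sub>L 'a"
  where "tsallis_entropy lam A = tsallis_relative_entropy lam A id_blinfun"

definition ln_tsallis :: "real \<Rightarrow> real \<Rightarrow> real"
  where "ln_tsallis lam x = (x powr lam - 1) / lam"

end

theory Submission
  imports Defs "HOL-Computational_Algebra.Fundamental_Theorem_Algebra"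
begin

text \<open>Put \<open>C = A\<^bsup>-1/2\<^esup> B A\<^bsup>-1/2\<^esup>\<close>. From \<open>B \<le> \<parallel>B\<parallel>\<close> one gets \<open>C \<le> \<parallel>B\<parallel> A\<^bsup>-1\<^esup>\<close>, and the Loewner-Heinz
  inequality yields \<open>C\<^bsup>\<lambda>\<^esup> \<le> \<parallel>B\<parallel>\<^bsup>\<lambda>\<^esup> A\<^bsup>-\<lambda>\<^esup>\<close>; conjugating with \<open>A\<^bsup>1/2\<^esup>\<close> gives (1). From \<open>\<mu> A \<le> B\<close> one
  gets \<open>\<mu> \<le> C\<close>, so \<open>\<mu>\<^bsup>\<lambda>\<^esup> \<le> C\<^bsup>\<lambda>\<^esup>\<close> by the functional calculus alone, and conjugating gives (2).

  The functional calculus rests on \<open>\<parallel>p(A)\<parallel> \<le> sup |p|\<close> over the spectrum for real polynomials \<open>p\<close>, which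
  only needs the underlying real Hilbert space: \<open>X\<^sup>2 - \<parallel>X\<parallel>\<^sup>2\<close> is never invertible for symmetric
  \<open>X \<noteq> 0\<close>, and a real polynomial \<open>q\<close> with \<open>q(A)\<close> not invertible has a root in the spectrum, because
  \<open>(A - a)\<^sup>2 + b\<^sup>2\<close> is invertible when \<open>b \<noteq> 0\<close>. For the Loewner-Heinz inequality, the exponents for
  which it holds form a closed set that contains 0 and 1 and is stable under midpoints.\<close>

subsection \<open>Symmetric operators and their real spectrum\<close>

lemma blinfun_compose_id: "id_blinfun o\<^sub>L X = X" "X o\<^sub>L id_blinfun = X"
  by (auto intro!: blinfun_eqI)

lemma power2_norm_minus:
  fixes x y :: "'a::real_inner"
  shows "(norm (x - y))\<^sup>2 = (norm x)\<^sup>2 - 2 * inner x y + (norm y)\<^sup>2"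
  unfolding power2_norm_eq_inner inner_diff_left inner_diff_right
  by (simp add: inner_commute)

section \<open>Invertible bounded operators and the Neumann series\<close>

lemma invertible_op_compose:
  assumes "invertible_op X" and "invertible_op Y"
  shows "invertible_op (X o\<^sub>L Y)"
proof -
  obtain C D where C: "X o\<^sub>L C = id_blinfun" "C o\<^sub>L X = id_blinfun"
    and D: "Y o\<^sub>L D = id_blinfun" "D o\<^sub>L Y = id_blinfun"
    using assms unfolding invertible_op_def by blast
  have C': "X (C v) = v" "C (X v) = v" and D': "Y (D v) = v" "D (Y v) = v" for v
    using C D by (metis blinfun_apply_blinfun_compose id_blinfun.rep_eq)+
  have "(X o\<^sub>L Y) o\<^sub>L (D o\<^sub>L C) = id_blinfun" "(D o\<^sub>L C) o\<^sub>L (X o\<^sub>L Y) = id_blinfun"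
    by (auto intro!: blinfun_eqI simp: C' D')
  then show ?thesis unfolding invertible_op_def by blast
qed

lemma invertible_op_scaleR:
  assumes "invertible_op X" and "c \<noteq> 0"
  shows "invertible_op (c *\<^sub>R X)"
proof -
  obtain C where C: "X o\<^sub>L C = id_blinfun" "C o\<^sub>L X = id_blinfun"
    using assms unfolding invertible_op_def by blast
  have C': "X (C v) = v" "C (X v) = v" for v
    using C by (metis blinfun_apply_blinfun_compose id_blinfun.rep_eq)+
  have "(c *\<^sub>R X) o\<^sub>L (inverse c *\<^sub>R C) = id_blinfun" "(inverse c *\<^sub>R C) o\<^sub>L (c *\<^sub>R X) = id_blinfun"
    using \<open>c \<noteq> 0\<close> by (auto intro!: blinfun_eqI simp: C' blinfun.scaleR_left blinfun.scaleR_right)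
  then show ?thesis unfolding invertible_op_def by blast
qed

text \<open>The inverse \<open>C\<close> of \<open>X^2\<close> commutes with \<open>X\<close>, so
  \<open>X C = C X\<close> inverts \<open>X\<close> on both sides.\<close>

lemma invertible_op_square_cancel:
  assumes "invertible_op (X o\<^sub>L X)"
  shows "invertible_op X"
proof -
  obtain C where C: "X o\<^sub>L X o\<^sub>L C = id_blinfun" "C o\<^sub>L (X o\<^sub>L X) = id_blinfun"
    using assms unfolding invertible_op_def by blast
  have C': "X (X (C v)) = v" "C (X (X v)) = v" for v
    using C by (metis blinfun_apply_blinfun_compose id_blinfun.rep_eq)+
  have "C (X v) = X (C v)" for v
    by (metis C')
  then have "X o\<^sub>L (C o\<^sub>L X) = id_blinfun" "(C o\<^sub>L X) o\<^sub>L X = id_blinfun"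
    by (auto intro!: blinfun_eqI simp: C')
  then show ?thesis unfolding invertible_op_def by blast
qed

lemma invertible_op_bounded_below:
  assumes "invertible_op X"
  obtains k where "k > 0" and "\<And>x. norm x \<le> k * norm (X x)"
proof -
  obtain C where C: "X o\<^sub>L C = id_blinfun" "C o\<^sub>L X = id_blinfun"
    using assms unfolding invertible_op_def by blast
  have C': "C (X v) = v" for v
    using C by (metis blinfun_apply_blinfun_compose id_blinfun.rep_eq)
  show ?thesis
  proof
    show "norm C + 1 > 0"
      by (smt (verit) norm_ge_zero)
    show "norm x \<le> (norm C + 1) * norm (X x)" for x
      using norm_blinfun[of C "X x"] C'[of x] norm_ge_zero[of "X x"]
      by (simp add: distrib_right add_increasing2)
  qed
qed

text \<open>Neumann series: the powers of \<open>S\<close> are summable by comparison with a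
  geometric series, and their sum is the inverse.\<close>

lemma invertible_op_id_minus:
  fixes S :: "'a::banach \<Rightarrow>\<^sub>L 'a"
  assumes "norm S < 1"
  shows "invertible_op (id_blinfun - S)"
proof -
  define P where "P n = ((\<lambda>X. S o\<^sub>L X) ^^ n) id_blinfun" for n
  have P0: "P 0 = id_blinfun" and PS: "P (Suc n) = S o\<^sub>L P n" for n
    by (simp_all add: P_def)
  \<comment> \<open>The sum has to be a left and a right inverse, so the recursion must also peel
    \<open>S\<close> off on the right.\<close>
  have PS': "P (Suc n) = P n o\<^sub>L S" for n
  proof (induction n)
    case 0
    show ?case by (auto intro!: blinfun_eqI simp: P0 PS)
  next
    case (Suc n)
    have "P (Suc (Suc n)) = S o\<^sub>L (P n o\<^sub>L S)"
      by (simp only: PS[of "Suc n"] Suc)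
    also have "\<dots> = P (Suc n) o\<^sub>L S"
      by (auto intro!: blinfun_eqI simp: PS)
    finally show ?case .
  qed
  have nP: "norm (P n) \<le> norm S ^ n" for n
  proof (induction n)
    case 0
    show ?case by (simp add: P0 norm_blinfun_id_le)
  next
    case (Suc n)
    have "norm (P (Suc n)) \<le> norm S * norm (P n)"
      unfolding PS by (rule norm_blinfun_compose)
    also have "\<dots> \<le> norm S * norm S ^ n"
      using Suc by (intro mult_left_mono) auto
    finally show ?case by simp
  qed
  have sm: "summable P"
    by (rule summable_comparison_test[OF _ summable_geometric[of "norm S"]]) (use nP assms in auto)
  have sp: "(\<Sum>n. P (Suc n)) = suminf P - id_blinfun"
    using suminf_split_head[OF sm] by (simp add: P0)
  have "S o\<^sub>L suminf P = suminf P - id_blinfun"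
    using bounded_linear.suminf[OF bounded_bilinear.bounded_linear_right[OF bounded_bilinear_blinfun_compose, of S] sm]
    by (simp add: sp flip: PS)
  moreover have "suminf P o\<^sub>L S = suminf P - id_blinfun"
    using bounded_linear.suminf[OF bounded_bilinear.bounded_linear_left[OF bounded_bilinear_blinfun_compose, of S] sm]
    by (simp add: sp flip: PS')
  ultimately have "(id_blinfun - S) o\<^sub>L suminf P = id_blinfun" "suminf P o\<^sub>L (id_blinfun - S) = id_blinfun"
    by (simp_all add: bounded_bilinear.diff_left[OF bounded_bilinear_blinfun_compose]
        bounded_bilinear.diff_right[OF bounded_bilinear_blinfun_compose]
        blinfun_compose_id)
  then show ?thesis unfolding invertible_op_def by blast
qed

definition symmetric_op :: "('a::real_inner \<Rightarrow>\<^sub>L 'a) \<Rightarrow> bool"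
  where "symmetric_op A \<longleftrightarrow> (\<forall>x y. inner (A x) y = inner x (A y))"

text \<open>Positivity with a uniform constant. For symmetric operators with nonnegative quadratic
  form this amounts to invertibility, by \<open>coercive_op_invertible\<close> and
  \<open>positive_invertible_coercive\<close>.\<close>

definition coercive_op :: "('a::real_inner \<Rightarrow>\<^sub>L 'a) \<Rightarrow> bool"
  where "coercive_op A \<longleftrightarrow> (\<exists>b>0. \<forall>x. b * (norm x)\<^sup>2 \<le> inner (A x) x)"

text \<open>Only real scalars occur, so this makes sense without a complex structure. By
  \<open>real_spectrum_eq\<close> it consists of the real points of \<open>spectrum\<close>.\<close>

definition real_spectrum :: "('a::real_normed_vector \<Rightarrow>\<^sub>L 'a) \<Rightarrow> real set"
  where "real_spectrum A = {t. \<not> invertible_op (A - t *\<^sub>R id_blinfun)}"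

lemma symmetric_opD: "symmetric_op A \<Longrightarrow> inner (A x) y = inner x (A y)"
  by (simp add: symmetric_op_def)

lemma symmetric_op_intros [intro]:
  shows symmetric_op_0: "symmetric_op 0"
    and symmetric_op_id: "symmetric_op id_blinfun"
    and symmetric_op_add: "symmetric_op A \<Longrightarrow> symmetric_op B \<Longrightarrow> symmetric_op (A + B)"
    and symmetric_op_diff: "symmetric_op A \<Longrightarrow> symmetric_op B \<Longrightarrow> symmetric_op (A - B)"
    and symmetric_op_scaleR: "symmetric_op A \<Longrightarrow> symmetric_op (c *\<^sub>R A)"
    and symmetric_op_conj: "symmetric_op A \<Longrightarrow> symmetric_op B \<Longrightarrow> symmetric_op (A o\<^sub>L B o\<^sub>L A)"
  by (auto simp: symmetric_op_def blinfun.add_left blinfun.diff_left blinfun.scaleR_left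
      inner_add_left inner_add_right inner_diff_left inner_diff_right)

lemma inner_blinfun_le:
  fixes A :: "'a::real_inner \<Rightarrow>\<^sub>L 'a"
  shows "inner (A x) x \<le> norm A * (norm x)\<^sup>2"
proof -
  have "inner (A x) x \<le> norm (A x) * norm x"
    by (rule norm_cauchy_schwarz)
  also have "\<dots> \<le> norm A * norm x * norm x"
    by (intro mult_right_mono norm_blinfun) auto
  finally show ?thesis by (simp add: power2_eq_square mult.assoc)
qed

text \<open>For small \<open>s > 0\<close> the operator \<open>I - s X\<close> is a strict contraction.\<close>

lemma coercive_op_invertible:
  fixes X :: "'a::{real_inner,banach} \<Rightarrow>\<^sub>L 'a"
  assumes "coercive_op X"
  shows "invertible_op X"
proof -
  obtain b where b: "b > 0" "\<And>x. b * (norm x)\<^sup>2 \<le> inner (X x) x"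
    using assms unfolding coercive_op_def by blast
  \<comment> \<open>The maximum with \<open>b\<close> ensures \<open>b \<le> M\<close>, so that the
    radicand in \<open>q\<close> below is nonnegative.\<close>
  define M where "M = max (norm X) b"
  have M: "M > 0" "norm X \<le> M" "b \<le> M" using b by (auto simp: M_def)
  \<comment> \<open>This \<open>s\<close> minimizes \<open>1 - 2 s b + s^2 M^2\<close>, the bound
    for the squared norm of \<open>I - s X\<close>; the minimum is
    \<open>1 - b^2 / M^2 = q^2\<close>.\<close>
  define s where "s = b / M\<^sup>2"
  have s: "s > 0" using b M by (simp add: s_def)
  define q where "q = sqrt (1 - b\<^sup>2 / M\<^sup>2)"
  have bM: "b\<^sup>2 / M\<^sup>2 \<le> 1" "0 < b\<^sup>2 / M\<^sup>2"
    using b M by (simp_all add: power_mono)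
  have q: "0 \<le> q" "q < 1"
    using bM by (auto simp: q_def)
  have "norm ((id_blinfun - s *\<^sub>R X) x) \<le> q * norm x" for x
  proof -
    have e: "(id_blinfun - s *\<^sub>R X) x = x - s *\<^sub>R X x"
      by (simp add: blinfun.diff_left blinfun.scaleR_left)
    have "(norm (x - s *\<^sub>R X x))\<^sup>2 = (norm x)\<^sup>2 - 2 * s * inner (X x) x + s\<^sup>2 * (norm (X x))\<^sup>2"
      unfolding power2_norm_minus by (simp add: power_mult_distrib inner_commute)
    also have "\<dots> \<le> (norm x)\<^sup>2 - 2 * s * (b * (norm x)\<^sup>2) + s\<^sup>2 * (M * norm x)\<^sup>2"
    proof -
      have "norm (X x) \<le> M * norm x"
        using norm_blinfun[of X x] M(2) mult_right_mono[OF M(2), of "norm x"] by simp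
      then have "(norm (X x))\<^sup>2 \<le> (M * norm x)\<^sup>2"
        by (intro power_mono) auto
      moreover have "2 * s * (b * (norm x)\<^sup>2) \<le> 2 * s * inner (X x) x"
        using b(2)[of x] s by simp
      moreover have "s\<^sup>2 * (norm (X x))\<^sup>2 \<le> s\<^sup>2 * (M * norm x)\<^sup>2"
        using calculation(1) by (intro mult_left_mono) auto
      ultimately show ?thesis by linarith
    qed
    also have "\<dots> = (1 - b\<^sup>2 / M\<^sup>2) * (norm x)\<^sup>2"
    proof -
      have "s * b = b\<^sup>2 / M\<^sup>2" "s\<^sup>2 * M\<^sup>2 = b\<^sup>2 / M\<^sup>2"
        using M by (simp_all add: s_def power2_eq_square)
      moreover have "r - 2 * s * (b * r) + s\<^sup>2 * (M\<^sup>2 * r) = r - 2 * (s * b) * r + s\<^sup>2 * M\<^sup>2 * r"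
        for r :: real by (simp only: mult.assoc)
      moreover have "r - 2 * u * r + u * r = (1 - u) * r" for r u :: real
        by (simp add: algebra_simps)
      ultimately show ?thesis by (simp only: power_mult_distrib)
    qed
    also have "\<dots> = (q * norm x)\<^sup>2"
      using bM by (simp add: q_def power_mult_distrib)
    finally show ?thesis
      unfolding e by (rule power2_le_imp_le) (use q in simp)
  qed
  then have "norm (id_blinfun - s *\<^sub>R X) \<le> q"
    using q by (intro norm_blinfun_bound) auto
  then have "norm (id_blinfun - s *\<^sub>R X) < 1"
    using q by (simp add: algebra_simps)
  from invertible_op_id_minus[OF this] have "invertible_op (s *\<^sub>R X)" by simp
  from invertible_op_scaleR[OF this, of "inverse s"] show ?thesis using s by simp
qed

text \<open>By symmetry the quadratic form of \<open>X^2\<close> at \<open>x\<close> is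
  \<open>|X x|^2\<close>, so \<open>X^2\<close> is coercive, hence invertible, and then so is
  \<open>X\<close>.\<close>

lemma symmetric_op_bounded_below_invertible:
  fixes X :: "'a::{real_inner,banach} \<Rightarrow>\<^sub>L 'a"
  assumes "symmetric_op X" and "b > 0" and "\<And>x. b * norm x \<le> norm (X x)"
  shows "invertible_op X"
proof -
  have "b\<^sup>2 * (norm x)\<^sup>2 \<le> inner ((X o\<^sub>L X) x) x" for x
    using power_mono[OF assms(3)[of x], of 2] assms
    by (simp add: symmetric_opD power2_norm_eq_inner[of "X x"] power_mult_distrib inner_commute)
  then have "coercive_op (X o\<^sub>L X)"
    unfolding coercive_op_def using \<open>b > 0\<close> by (intro exI[of _ "b\<^sup>2"]) auto
  then show ?thesis
    using coercive_op_invertible invertible_op_square_cancel by blast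
qed

text \<open>Positivity at the single vector \<open>x - A x / m\<close>, with
  \<open>m \<ge> |A|\<close>, gives \<open>|A x|^2 \<le> m <A x, x>\<close>. Invertibility bounds
  \<open>|x|\<close> by a multiple of \<open>|A x|\<close>.\<close>

lemma positive_invertible_coercive:
  assumes sym: "symmetric_op A" and pos: "\<And>x. 0 \<le> inner (A x) x" and "invertible_op A"
  shows "coercive_op A"
proof -
  obtain k where k: "k > 0" "\<And>x. norm x \<le> k * norm (A x)"
    using invertible_op_bounded_below[OF assms(3)] by blast
  define m where "m = norm A + 1"
  have m: "m > 0" "norm A \<le> m"
    unfolding m_def by (simp_all add: add_nonneg_pos)
  have "(norm (A x))\<^sup>2 \<le> m * inner (A x) x" for x
  proof -
    define s where "s = 1 / m"
    have s: "s > 0" using m by (simp add: s_def)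
    have "0 \<le> inner (A (x - s *\<^sub>R A x)) (x - s *\<^sub>R A x)"
      by (rule pos)
    also have "\<dots> = inner (A x) x - 2 * s * (norm (A x))\<^sup>2 + s * (s * inner (A (A x)) (A x))"
      using symmetric_opD[OF sym, of "A x" x]
      by (simp add: blinfun.diff_right blinfun.scaleR_right inner_diff_left inner_diff_right
          power2_norm_eq_inner algebra_simps)
    also have "s * (s * inner (A (A x)) (A x)) \<le> s * (s * (m * (norm (A x))\<^sup>2))"
      using s inner_blinfun_le[of A "A x"] mult_right_mono[OF m(2), of "(norm (A x))\<^sup>2"]
      by (intro mult_left_mono) auto
    also have "\<dots> = s * (norm (A x))\<^sup>2"
      using m by (simp add: s_def)
    finally show ?thesis
      using m by (simp add: s_def field_simps)
  qed
  moreover have "(norm x)\<^sup>2 \<le> k\<^sup>2 * (norm (A x))\<^sup>2" for x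
    using power_mono[OF k(2)[of x], of 2] by (simp add: power_mult_distrib)
  ultimately have "(norm x)\<^sup>2 \<le> k\<^sup>2 * (m * inner (A x) x)" for x
    by (meson mult_left_mono order_trans zero_le_power2)
  then have "1 / (k\<^sup>2 * m) * (norm x)\<^sup>2 \<le> inner (A x) x" for x
    using k m by (simp add: field_simps)
  moreover have "1 / (k\<^sup>2 * m) > 0" using k m by simp
  ultimately show ?thesis unfolding coercive_op_def by blast
qed

text \<open>If \<open>t\<close> lay strictly outside the bounds of the quadratic form,
  \<open>A - t\<close> or its negative would be coercive, hence invertible.\<close>

lemma real_spectrum_bounds:
  fixes A :: "'a::{real_inner,banach} \<Rightarrow>\<^sub>L 'a"
  assumes "t \<in> real_spectrum A"
  shows real_spectrum_ge: "(\<And>x. a * (norm x)\<^sup>2 \<le> inner (A x) x) \<Longrightarrow> a \<le> t"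
    and real_spectrum_le: "(\<And>x. inner (A x) x \<le> b * (norm x)\<^sup>2) \<Longrightarrow> t \<le> b"
proof -
  have n: "\<not> invertible_op (A - t *\<^sub>R id_blinfun)"
    using assms by (simp add: real_spectrum_def)
  show "a \<le> t" if a: "\<And>x. a * (norm x)\<^sup>2 \<le> inner (A x) x"
  proof (rule ccontr)
    assume "\<not> a \<le> t"
    moreover have "(a - t) * (norm x)\<^sup>2 \<le> inner ((A - t *\<^sub>R id_blinfun) x) x" for x
      using a[of x] by (simp add: blinfun.diff_left blinfun.scaleR_left inner_diff_left power2_norm_eq_inner algebra_simps)
    ultimately have "coercive_op (A - t *\<^sub>R id_blinfun)"
      unfolding coercive_op_def by (intro exI[of _ "a - t"]) auto
    then show False using n coercive_op_invertible by blast
  qed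
  show "t \<le> b" if b: "\<And>x. inner (A x) x \<le> b * (norm x)\<^sup>2"
  proof (rule ccontr)
    assume "\<not> t \<le> b"
    moreover have "(t - b) * (norm x)\<^sup>2 \<le> inner (((-1) *\<^sub>R (A - t *\<^sub>R id_blinfun)) x) x" for x
      using b[of x] by (simp add: blinfun.diff_left blinfun.minus_left blinfun.scaleR_left inner_diff_left power2_norm_eq_inner algebra_simps)
    ultimately have "coercive_op ((-1) *\<^sub>R (A - t *\<^sub>R id_blinfun))"
      unfolding coercive_op_def by (intro exI[of _ "t - b"]) auto
    then have "invertible_op ((-1) *\<^sub>R (A - t *\<^sub>R id_blinfun))"
      by (rule coercive_op_invertible)
    from invertible_op_scaleR[OF this, of "-1"] show False using n by simp
  qed
qed

lemma real_spectrum_norm: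
  fixes A :: "'a::{real_inner,banach} \<Rightarrow>\<^sub>L 'a"
  shows "real_spectrum A \<subseteq> {- norm A..norm A}"
proof
  fix t assume t: "t \<in> real_spectrum A"
  have "- norm A * (norm x)\<^sup>2 \<le> inner (A x) x" for x
    using inner_blinfun_le[of "-A" x] by (simp add: blinfun.minus_left)
  then show "t \<in> {- norm A..norm A}"
    using real_spectrum_ge[OF t] real_spectrum_le[OF t inner_blinfun_le] by auto
qed

text \<open>Write \<open>M\<close> for the norm of \<open>X\<close>. If \<open>X^2 - M^2\<close>
  were bounded below, expanding \<open>|X^2 x - M^2 x|^2\<close> and using
  \<open>|X (X x)| \<le> M |X x|\<close> would yield \<open>|X x|^2 \<le> (M^2 - d) |x|^2\<close>
  with a fixed \<open>d > 0\<close>, against the choice of \<open>M\<close> as the operator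
  norm.\<close>

lemma norm_square_not_invertible:
  fixes X :: "'a::real_inner \<Rightarrow>\<^sub>L 'a"
  assumes sym: "symmetric_op X" and "norm X > 0"
  shows "\<not> invertible_op ((X o\<^sub>L X) - (norm X)\<^sup>2 *\<^sub>R id_blinfun)"
proof
  define M where "M = norm X"
  have M: "M > 0" using assms by (simp add: M_def)
  define Y where "Y = (X o\<^sub>L X) - (norm X)\<^sup>2 *\<^sub>R id_blinfun"
  assume "invertible_op ((X o\<^sub>L X) - (norm X)\<^sup>2 *\<^sub>R id_blinfun)"
  then have "invertible_op Y" by (simp add: Y_def)
  then obtain k where k: "k > 0" "\<And>x. norm x \<le> k * norm (Y x)"
    using invertible_op_bounded_below by blast
  define d where "d = 1 / (k\<^sup>2 * M\<^sup>2)"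
  have d: "d > 0" using k M by (simp add: d_def)
  have main: "(norm (X x))\<^sup>2 \<le> (M\<^sup>2 - d) * (norm x)\<^sup>2" for x
  proof -
    have "Y x = X (X x) - M\<^sup>2 *\<^sub>R x"
      by (simp add: Y_def M_def blinfun.diff_left blinfun.scaleR_left)
    then have "(norm (Y x))\<^sup>2 = (norm (X (X x) - M\<^sup>2 *\<^sub>R x))\<^sup>2"
      by (simp only:)
    also have "\<dots> = (norm (X (X x)))\<^sup>2 - 2 * M\<^sup>2 * (norm (X x))\<^sup>2 + M\<^sup>2 * M\<^sup>2 * (norm x)\<^sup>2"
      unfolding power2_norm_minus inner_scaleR_right norm_scaleR symmetric_opD[OF sym, of "X x" x] dot_square_norm
      by (simp add: power_mult_distrib power2_eq_square[of "M\<^sup>2"])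
    finally have "(norm (Y x))\<^sup>2 = (norm (X (X x)))\<^sup>2 - 2 * M\<^sup>2 * (norm (X x))\<^sup>2 + M\<^sup>2 * M\<^sup>2 * (norm x)\<^sup>2" .
    moreover have "(norm (X (X x)))\<^sup>2 \<le> M\<^sup>2 * (norm (X x))\<^sup>2"
      using power_mono[OF norm_blinfun[of X "X x"], of 2] by (simp add: M_def power_mult_distrib)
    ultimately have "(norm (Y x))\<^sup>2 \<le> M\<^sup>2 * (M\<^sup>2 * (norm x)\<^sup>2 - (norm (X x))\<^sup>2)"
      by (simp add: algebra_simps)
    then have "k\<^sup>2 * (norm (Y x))\<^sup>2 \<le> k\<^sup>2 * (M\<^sup>2 * (M\<^sup>2 * (norm x)\<^sup>2 - (norm (X x))\<^sup>2))"
      by (intro mult_left_mono) auto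
    moreover have "(norm x)\<^sup>2 \<le> k\<^sup>2 * (norm (Y x))\<^sup>2"
      using power_mono[OF k(2)[of x], of 2] by (simp add: power_mult_distrib)
    ultimately have "(norm x)\<^sup>2 \<le> k\<^sup>2 * M\<^sup>2 * (M\<^sup>2 * (norm x)\<^sup>2 - (norm (X x))\<^sup>2)"
      by (simp add: mult.assoc)
    then have "d * (norm x)\<^sup>2 \<le> M\<^sup>2 * (norm x)\<^sup>2 - (norm (X x))\<^sup>2"
      using k M by (simp add: d_def field_simps)
    then show ?thesis by (simp add: algebra_simps)
  qed
  \<comment> \<open>The value \<open>M^2 - d\<close> might be negative, hence the truncation at 0
    before taking the root.\<close>
  define r where "r = sqrt (max 0 (M\<^sup>2 - d))"
  have "norm X \<le> r"
  proof (rule norm_blinfun_bound)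
    show "0 \<le> r" by (simp add: r_def)
    fix x
    have "(norm (X x))\<^sup>2 \<le> max 0 (M\<^sup>2 - d) * (norm x)\<^sup>2"
      using main[of x] by (smt (verit) mult_right_mono zero_le_power2)
    also have "\<dots> = (r * norm x)\<^sup>2"
      by (simp add: r_def power_mult_distrib)
    finally show "norm (X x) \<le> r * norm x"
      by (rule power2_le_imp_le) (simp add: r_def)
  qed
  then have "M\<^sup>2 \<le> r\<^sup>2" using M by (simp add: M_def power_mono)
  moreover have "r\<^sup>2 < M\<^sup>2" using d M by (simp add: r_def)
  ultimately show False by simp
qed

subsection \<open>Polynomials of a symmetric operator\<close>

lemma op_poly_0 [simp]: "op_poly 0 A = 0"
  by (simp add: op_poly_def)

text \<open>Horner's rule. It turns the sum of powers into a recursion, so the algebra of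
  \<open>op_poly\<close> follows by induction on polynomials. The case \<open>p = 0\<close> is
  separate because the degree does not grow there.\<close>

lemma op_poly_pCons: "op_poly (pCons a p) A = a *\<^sub>R id_blinfun + (A o\<^sub>L op_poly p A)"
proof (cases "p = 0")
  case True
  then show ?thesis
    by (simp add: op_poly_def bounded_bilinear.zero_right[OF bounded_bilinear_blinfun_compose])
next
  case False
  have "op_poly (pCons a p) A = a *\<^sub>R id_blinfun +
      (\<Sum>i\<le>degree p. coeff p i *\<^sub>R (A o\<^sub>L ((\<lambda>X. A o\<^sub>L X) ^^ i) id_blinfun))"
    using False by (simp add: op_poly_def sum.atMost_Suc_shift del: sum.atMost_Suc)
  also have "(\<Sum>i\<le>degree p. coeff p i *\<^sub>R (A o\<^sub>L ((\<lambda>X. A o\<^sub>L X) ^^ i) id_blinfun)) =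
      A o\<^sub>L op_poly p A"
    by (simp add: op_poly_def bounded_bilinear.sum_right[OF bounded_bilinear_blinfun_compose]
        bounded_bilinear.scaleR_right[OF bounded_bilinear_blinfun_compose])
  finally show ?thesis .
qed

lemma op_poly_const: "op_poly [:c:] A = c *\<^sub>R id_blinfun"
  by (simp add: op_poly_pCons bounded_bilinear.zero_right[OF bounded_bilinear_blinfun_compose])

lemma op_poly_linear: "op_poly [:c, 1:] A = A + c *\<^sub>R id_blinfun"
  by (auto intro!: blinfun_eqI simp: op_poly_pCons blinfun.add_left)

lemma op_poly_add: "op_poly (p + q) A = op_poly p A + op_poly q A"
proof (induction p q rule: poly_induct2)
  case (pCons a p b q)
  then show ?case
    by (auto intro!: blinfun_eqI simp: op_poly_pCons blinfun.add_left blinfun.add_right blinfun.scaleR_left scaleR_add_left)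
qed simp

lemma op_poly_smult: "op_poly (smult c p) A = c *\<^sub>R op_poly p A"
  by (induction p)
    (auto intro!: blinfun_eqI simp: op_poly_pCons blinfun.add_left blinfun.scaleR_left blinfun.scaleR_right scaleR_add_right)

lemma op_poly_mult: "op_poly (p * q) A = op_poly p A o\<^sub>L op_poly q A"
  by (induction p)
    (auto intro!: blinfun_eqI simp: op_poly_pCons op_poly_add op_poly_smult blinfun.add_left blinfun.scaleR_left)

lemma op_poly_diff: "op_poly (p - q) A = op_poly p A - op_poly q A"
  using op_poly_add[of p "-q" A] op_poly_smult[of "-1" q A] by simp

text \<open>A product of symmetric operators is symmetric when they commute. That \<open>A\<close>
  commutes with \<open>p(A)\<close> is read off from commutativity of polynomial
  multiplication.\<close>

lemma symmetric_op_poly: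
  assumes "symmetric_op A"
  shows "symmetric_op (op_poly p A)"
proof (induction p)
  case (pCons a p)
  have "op_poly ([:0, 1:] * p) A = op_poly (p * [:0, 1:]) A"
    by (simp only: mult.commute)
  then have "A (op_poly p A x) = op_poly p A (A x)" for x
    unfolding op_poly_mult op_poly_linear
    by (metis add.right_neutral blinfun_apply_blinfun_compose scaleR_zero_left)
  then have "symmetric_op (A o\<^sub>L op_poly p A)"
    using assms pCons unfolding symmetric_op_def by simp
  then show ?case
    unfolding op_poly_pCons by auto
qed auto

lemma poly_map_of_real_add:
  "map_poly complex_of_real (p + q) = map_poly of_real p + map_poly of_real q"
  by (intro poly_eqI) (simp add: coeff_map_poly)

lemma poly_map_of_real_mult:
  "map_poly complex_of_real (p * q) = map_poly of_real p * map_poly of_real q"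
  by (intro poly_eqI) (simp add: coeff_map_poly coeff_mult)

text \<open>The complexified polynomial has a root \<open>z\<close>. A real \<open>z\<close> splits
  off a linear factor, and a nonreal \<open>z\<close> splits off the quadratic
  \<open>(X - Re z)^2 + (Im z)^2\<close> that vanishes at \<open>z\<close> and its
  conjugate.\<close>

lemma real_poly_factor:
  fixes q :: "real poly"
  assumes "degree q > 0"
  obtains (linear) z q' where "q = [:-z, 1:] * q'"
  | (quadratic) a b q' where "b \<noteq> 0" and "q = ([:-a, 1:] * [:-a, 1:] + [:b\<^sup>2:]) * q'"
proof -
  let ?c = "\<lambda>p. map_poly complex_of_real p"
  have "\<not> constant (poly (?c q))"
    using assms by (simp add: constant_degree degree_map_poly)
  then obtain z where z: "poly (?c q) z = 0"
    using fundamental_theorem_of_algebra by blast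
  show ?thesis
  proof (cases "Im z = 0")
    case True
    then have "z = of_real (Re z)" by (simp add: complex_eq_iff)
    then have "poly (?c q) (of_real (Re z)) = 0" using z by simp
    then have "complex_of_real (poly q (Re z)) = 0"
      by (simp add: poly_altdef degree_map_poly coeff_map_poly)
    then have "[:- Re z, 1:] dvd q"
      by (simp add: poly_eq_0_iff_dvd)
    then show ?thesis using linear by (auto elim: dvdE)
  next
    case False
    define d where "d = [:- Re z, 1:] * [:- Re z, 1:] + [:(Im z)\<^sup>2:]"
    have d: "degree d = 2" by (simp add: d_def)
    have dz: "poly (?c d) z = 0"
      by (simp add: d_def map_poly_pCons complex_eq_iff power2_eq_square)
    have r: "degree (q mod d) < 2"
      using degree_mod_less[of d q] d by fastforce
    define u v where "u = coeff (q mod d) 0" and "v = coeff (q mod d) 1"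
    have uv: "q mod d = [:u, v:]"
      by (rule poly_eqI) (use r in \<open>auto simp: u_def v_def coeff_pCons coeff_eq_0 split: nat.splits\<close>)
    have "q = d * (q div d) + [:u, v:]"
      using uv by (metis mult_div_mod_eq)
    then have "poly (?c (d * (q div d) + [:u, v:])) z = 0" using z by simp
    \<comment> \<open>The remainder modulo \<open>d\<close> is a real polynomial of degree at most
      1; vanishing at a nonreal point, it is zero.\<close>
    then have "complex_of_real u + z * of_real v = 0"
      using dz by (simp add: poly_map_of_real_add poly_map_of_real_mult map_poly_pCons)
    then have "u = 0" "v = 0"
      using False by (auto simp: complex_eq_iff)
    then have "q = d * (q div d)"
      using uv by (metis add.right_neutral mult_div_mod_eq pCons_0_0)
    then show ?thesis using quadratic[OF False] d_def by blast
  qed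
qed

text \<open>Induction on the degree, splitting with \<open>real_poly_factor\<close>: some factor of
  \<open>q(A)\<close> is not invertible. A linear factor puts its root into the spectrum, a
  quadratic one is coercive and cannot fail, and the cofactor has smaller degree.\<close>

lemma op_poly_not_invertible_root:
  fixes A :: "'a::{real_inner,banach} \<Rightarrow>\<^sub>L 'a"
  assumes sym: "symmetric_op A"
  shows "q \<noteq> 0 \<Longrightarrow> \<not> invertible_op (op_poly q A) \<Longrightarrow> \<exists>t\<in>real_spectrum A. poly q t = 0"
proof (induction "degree q" arbitrary: q rule: less_induct)
  case less
  have id: "invertible_op (id_blinfun :: 'a \<Rightarrow>\<^sub>L 'a)"
    unfolding invertible_op_def by (intro exI[of _ id_blinfun]) (simp add: blinfun_compose_id)
  show ?case
  proof (cases "degree q = 0")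
    case True
    then obtain c where "q = [:c:]" by (meson degree_eq_zeroE)
    then show ?thesis
      using less.prems invertible_op_scaleR[OF id, of c] by (simp add: op_poly_const)
  next
    case False
    then have "degree q > 0" by simp
    then show ?thesis
    proof (cases rule: real_poly_factor)
      case (linear z q')
      have "\<not> invertible_op (op_poly [:-z, 1:] A) \<or> \<not> invertible_op (op_poly q' A)"
        using less.prems invertible_op_compose unfolding linear op_poly_mult by blast
      then show ?thesis
      proof
        assume "\<not> invertible_op (op_poly [:-z, 1:] A)"
        then have "z \<in> real_spectrum A"
          by (simp add: real_spectrum_def op_poly_linear)
        then show ?thesis by (intro bexI[of _ z]) (simp add: linear)
      next
        assume n: "\<not> invertible_op (op_poly q' A)"
        have q': "q' \<noteq> 0" using less.prems linear by auto
        then have "degree q' < degree q" unfolding linear by (subst degree_mult_eq) auto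
        from less.hyps[OF this q' n] show ?thesis by (auto simp: linear)
      qed
    next
      case (quadratic a b q')
      have "coercive_op (op_poly ([:-a, 1:] * [:-a, 1:] + [:b\<^sup>2:]) A)"
      proof -
        define W where "W = op_poly [:-a, 1:] A"
        have W: "inner (W (W x)) x = (norm (W x))\<^sup>2" for x
          using symmetric_op_poly[OF sym, of "[:-a, 1:]"] unfolding W_def
          by (simp add: symmetric_opD power2_norm_eq_inner)
        have "b\<^sup>2 * (norm x)\<^sup>2 \<le> inner (op_poly ([:-a, 1:] * [:-a, 1:] + [:b\<^sup>2:]) A x) x" for x
          unfolding op_poly_add op_poly_mult op_poly_const W_def[symmetric]
          by (simp add: blinfun.add_left blinfun.scaleR_left inner_add_left W dot_square_norm)
        then show ?thesis
          using quadratic(1) unfolding coercive_op_def by (intro exI[of _ "b\<^sup>2"]) auto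
      qed
      then have "invertible_op (op_poly ([:-a, 1:] * [:-a, 1:] + [:b\<^sup>2:]) A)"
        by (rule coercive_op_invertible)
      then have n: "\<not> invertible_op (op_poly q' A)"
        using less.prems(2) invertible_op_compose unfolding quadratic(2) op_poly_mult[of _ q'] by blast
      have q': "q' \<noteq> 0" using less.prems quadratic by auto
      have "degree ([:-a, 1:] * [:-a, 1:] + [:b\<^sup>2:]) = 2" by simp
      then have "degree q' < degree q"
        unfolding quadratic(2) using q' by (subst degree_mult_eq) auto
      from less.hyps[OF this q' n] show ?thesis unfolding quadratic(2) poly_mult by auto
    qed
  qed
qed

text \<open>With \<open>M\<close> the norm of \<open>p(A)\<close>, the polynomial \<open>p\<^sup>2 - M\<^sup>2\<close> has a root in the spectrum.\<close>

lemma norm_op_poly_le: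
  fixes A :: "'a::{real_inner,banach} \<Rightarrow>\<^sub>L 'a"
  assumes sym: "symmetric_op A" and "c \<ge> 0" and c: "\<And>t. t \<in> real_spectrum A \<Longrightarrow> \<bar>poly p t\<bar> \<le> c"
  shows "norm (op_poly p A) \<le> c"
proof (cases "norm (op_poly p A) = 0")
  case False
  have root: "\<exists>t\<in>real_spectrum A. \<bar>poly p t\<bar> = norm (op_poly p A)"
    if M: "norm (op_poly p A) > 0" and nz: "p * p - [:(norm (op_poly p A))\<^sup>2:] \<noteq> 0" for p
  proof -
    have "\<not> invertible_op (op_poly (p * p - [:(norm (op_poly p A))\<^sup>2:]) A)"
      using norm_square_not_invertible[OF symmetric_op_poly[OF sym, of p] M]
      unfolding op_poly_diff op_poly_mult op_poly_const .
    from op_poly_not_invertible_root[OF sym nz this] obtain t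
      where "t \<in> real_spectrum A" "(poly p t)\<^sup>2 = (norm (op_poly p A))\<^sup>2"
      by (auto simp: power2_eq_square)
    then show ?thesis
      by (intro bexI[of _ t]) (auto simp: power2_eq_iff)
  qed
  define M where "M = norm (op_poly p A)"
  have "M > 0" using False by (simp add: M_def)
  show ?thesis
  proof (cases "p * p - [:M\<^sup>2:] = 0")
    case False
    then show ?thesis using root[of p] \<open>M > 0\<close> c unfolding M_def by fastforce
  next
    case True
    \<comment> \<open>Here \<open>p^2 - M^2\<close> is the zero polynomial and yields no root. But
      \<open>|p|\<close> is then constantly \<open>M\<close>, so it is enough to find any spectral
      point, which the argument applied to the polynomial \<open>X\<close> supplies when
      \<open>A\<close> is nonzero.\<close>
    have "\<exists>t. t \<in> real_spectrum A"
    proof (cases "A = 0")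
      case A: True
      have "op_poly p A \<noteq> 0" using \<open>M > 0\<close> M_def by auto
      then obtain x :: 'a where "x \<noteq> 0"
        by (metis blinfun.zero_left blinfun.zero_right blinfun_eqI)
      then have "\<not> invertible_op (0 :: 'a \<Rightarrow>\<^sub>L 'a)"
        using invertible_op_bounded_below[of "0 :: 'a \<Rightarrow>\<^sub>L 'a"] by force
      then show ?thesis by (intro exI[of _ 0]) (simp add: A real_spectrum_def)
    next
      case False
      have "op_poly [:0, 1:] A = A" by (simp add: op_poly_linear)
      then show ?thesis using root[of "[:0, 1:]"] False by auto
    qed
    then obtain t where t: "t \<in> real_spectrum A" by blast
    have "(poly p t)\<^sup>2 = M\<^sup>2"
      using arg_cong[OF True, of "\<lambda>p. poly p t"] by (simp add: power2_eq_square)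
    then have "\<bar>poly p t\<bar> = M" using \<open>M > 0\<close> by (auto simp: power2_eq_iff)
    then show ?thesis using c[OF t] by (simp add: M_def)
  qed
qed (use assms in simp)

subsection \<open>Continuous functional calculus\<close>

text \<open>\<open>f(A) = T\<close> as a relation, which avoids the definite description of \<^const>\<open>fun_calc\<close>; the two
  agree for symmetric \<open>A\<close> by \<open>fun_calc_eqI\<close> below.\<close>

definition has_calc :: "('a::real_normed_vector \<Rightarrow>\<^sub>L 'a) \<Rightarrow> (real \<Rightarrow> real) \<Rightarrow> ('a \<Rightarrow>\<^sub>L 'a) \<Rightarrow> bool"
  where "has_calc A f T \<longleftrightarrow>
    (\<forall>e>0. \<exists>p. (\<forall>t\<in>real_spectrum A. \<bar>poly p t - f t\<bar> < e) \<and> norm (op_poly p A - T) < e)"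

lemma has_calc_poly: "has_calc A (poly p) (op_poly p A)"
  unfolding has_calc_def by (intro allI impI exI[of _ p]) simp

lemma has_calc_const: "has_calc A (\<lambda>t. c) (c *\<^sub>R id_blinfun)"
proof -
  have "poly [:c:] = (\<lambda>t. c)" by auto
  then show ?thesis
    using has_calc_poly[of A "[:c:]"] by (simp add: op_poly_const)
qed

lemma has_calc_ident: "has_calc A (\<lambda>t. t) A"
proof -
  have "poly [:0, 1:] = (\<lambda>t::real. t)" by auto
  then show ?thesis
    using has_calc_poly[of A "[:0, 1:]"] by (simp add: op_poly_linear)
qed

lemma has_calc_cong:
  assumes "has_calc A f T" and "\<And>t. t \<in> real_spectrum A \<Longrightarrow> f t = g t"
  shows "has_calc A g T"
  using assms unfolding has_calc_def by simp

text \<open>The approximants may be any functions already covered by the calculus; in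
  \<open>has_calc_compose\<close> they are of the form \<open>poly q (f t)\<close> and need not be
  polynomials in \<open>t\<close>.\<close>

lemma has_calc_limit:
  assumes "\<And>e. e > 0 \<Longrightarrow>
    \<exists>g U. has_calc A g U \<and> (\<forall>t\<in>real_spectrum A. \<bar>g t - f t\<bar> \<le> e) \<and> norm (U - T) \<le> e"
  shows "has_calc A f T"
  unfolding has_calc_def
proof (intro allI impI)
  fix e :: real assume e: "e > 0"
  obtain g U where g: "has_calc A g U" "\<And>t. t \<in> real_spectrum A \<Longrightarrow> \<bar>g t - f t\<bar> \<le> e / 2" "norm (U - T) \<le> e / 2"
    using assms[of "e / 2"] e by auto
  obtain p where p: "\<And>t. t \<in> real_spectrum A \<Longrightarrow> \<bar>poly p t - g t\<bar> < e / 2" "norm (op_poly p A - U) < e / 2"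
    using g(1) e unfolding has_calc_def by (meson half_gt_zero)
  have "\<bar>poly p t - f t\<bar> < e" if "t \<in> real_spectrum A" for t
    using p(1)[OF that] g(2)[OF that] by linarith
  moreover have "norm (op_poly p A - T) < e"
    using p(2) g(3) norm_triangle_ineq[of "op_poly p A - U" "U - T"] by simp
  ultimately show "\<exists>p. (\<forall>t\<in>real_spectrum A. \<bar>poly p t - f t\<bar> < e) \<and> norm (op_poly p A - T) < e"
    by blast
qed

text \<open>Choosing errors \<open>1/(n+1)\<close> passes to sequences. This form gives access to
  the limit theorems for sums and products and matches the shape of \<open>fun_calc\<close>.\<close>

lemma has_calc_sequence:
  "has_calc A f T \<longleftrightarrow> (\<exists>p. uniform_limit (real_spectrum A) (\<lambda>n. poly (p n)) f sequentially \<and>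
    (\<lambda>n. op_poly (p n) A) \<longlonglongrightarrow> T)"
proof
  assume "has_calc A f T"
  then have "\<forall>n. \<exists>p. (\<forall>t\<in>real_spectrum A. \<bar>poly p t - f t\<bar> < inverse (real (Suc n))) \<and>
      norm (op_poly p A - T) < inverse (real (Suc n))"
    unfolding has_calc_def by (metis inverse_positive_iff_positive of_nat_0_less_iff zero_less_Suc)
  then obtain p where p: "\<And>n t. t \<in> real_spectrum A \<Longrightarrow> \<bar>poly (p n) t - f t\<bar> < inverse (real (Suc n))"
      "\<And>n. norm (op_poly (p n) A - T) < inverse (real (Suc n))"
    by metis
  have small: "\<forall>\<^sub>F n in sequentially. inverse (real (Suc n)) < e" if "e > 0" for e
    using order_tendstoD(2)[OF LIMSEQ_inverse_real_of_nat that] .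
  have "uniform_limit (real_spectrum A) (\<lambda>n. poly (p n)) f sequentially"
  proof (rule uniform_limitI)
    fix e :: real assume "e > 0"
    from small[OF this] show "\<forall>\<^sub>F n in sequentially. \<forall>t\<in>real_spectrum A. dist (poly (p n) t) (f t) < e"
      by eventually_elim (auto simp: dist_real_def simp del: of_nat_Suc intro: less_trans[OF p(1)])
  qed
  moreover have "(\<lambda>n. op_poly (p n) A) \<longlonglongrightarrow> T"
  proof (rule tendstoI)
    fix e :: real assume "e > 0"
    from small[OF this] show "\<forall>\<^sub>F n in sequentially. dist (op_poly (p n) A) T < e"
      by eventually_elim (auto simp: dist_norm simp del: of_nat_Suc intro: less_trans[OF p(2)])
  qed
  ultimately show "\<exists>p. uniform_limit (real_spectrum A) (\<lambda>n. poly (p n)) f sequentially \<and>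
      (\<lambda>n. op_poly (p n) A) \<longlonglongrightarrow> T"
    by blast
next
  assume "\<exists>p. uniform_limit (real_spectrum A) (\<lambda>n. poly (p n)) f sequentially \<and>
    (\<lambda>n. op_poly (p n) A) \<longlonglongrightarrow> T"
  then obtain p where p: "uniform_limit (real_spectrum A) (\<lambda>n. poly (p n)) f sequentially"
    "(\<lambda>n. op_poly (p n) A) \<longlonglongrightarrow> T" by blast
  show "has_calc A f T"
    unfolding has_calc_def
  proof (intro allI impI)
    fix e :: real assume "e > 0"
    have "\<forall>\<^sub>F n in sequentially. (\<forall>t\<in>real_spectrum A. dist (poly (p n) t) (f t) < e) \<and> dist (op_poly (p n) A) T < e"
      using uniform_limitD[OF p(1) \<open>e > 0\<close>] tendstoD[OF p(2) \<open>e > 0\<close>] by eventually_elim auto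
    from eventually_happens'[OF sequentially_bot this] obtain n
      where "(\<forall>t\<in>real_spectrum A. dist (poly (p n) t) (f t) < e) \<and> dist (op_poly (p n) A) T < e"
      by blast
    then show "\<exists>p. (\<forall>t\<in>real_spectrum A. \<bar>poly p t - f t\<bar> < e) \<and> norm (op_poly p A - T) < e"
      by (intro exI[of _ "p n"]) (auto simp: dist_norm)
  qed
qed

text \<open>A polynomial within distance 1 of \<open>f\<close> is bounded on a compact interval
  around the spectrum. The boundedness feeds the product rule for uniform limits in
  \<open>has_calc_mult\<close>.\<close>

lemma has_calc_bounded:
  fixes A :: "'a::{real_inner,banach} \<Rightarrow>\<^sub>L 'a"
  assumes "has_calc A f T"
  shows "bounded (f ` real_spectrum A)"
proof -
  obtain p where p: "\<And>t. t \<in> real_spectrum A \<Longrightarrow> \<bar>poly p t - f t\<bar> < 1"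
    using assms unfolding has_calc_def by (meson zero_less_one)
  have "compact (poly p ` {- norm A..norm A})"
    by (intro compact_continuous_image continuous_intros) auto
  then obtain c where c: "\<And>t. t \<in> {- norm A..norm A} \<Longrightarrow> \<bar>poly p t\<bar> \<le> c"
    using compact_imp_bounded bounded_iff by (metis image_eqI real_norm_def)
  have "norm (f t) \<le> c + 1" if "t \<in> real_spectrum A" for t
    using c[of t] p[OF that] real_spectrum_norm[of A] that by force
  then show ?thesis by (auto simp: bounded_iff)
qed

lemma poly_add_fun: "poly (p + q) = (\<lambda>t. poly p t + poly q t)"
  and poly_mult_fun: "poly (p * q) = (\<lambda>t. poly p t * poly q t)"
  by auto

lemma has_calc_add:
  assumes "has_calc A f T" and "has_calc A g U"
  shows "has_calc A (\<lambda>t. f t + g t) (T + U)"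
proof -
  obtain p q where p: "uniform_limit (real_spectrum A) (\<lambda>n. poly (p n)) f sequentially"
      "(\<lambda>n. op_poly (p n) A) \<longlonglongrightarrow> T"
    and q: "uniform_limit (real_spectrum A) (\<lambda>n. poly (q n)) g sequentially"
      "(\<lambda>n. op_poly (q n) A) \<longlonglongrightarrow> U"
    using assms unfolding has_calc_sequence by blast
  show ?thesis
    unfolding has_calc_sequence
    using uniform_limit_add[OF p(1) q(1)] tendsto_add[OF p(2) q(2)]
    by (intro exI[of _ "\<lambda>n. p n + q n"]) (simp add: op_poly_add poly_add_fun)
qed

lemma has_calc_mult:
  fixes A :: "'a::{real_inner,banach} \<Rightarrow>\<^sub>L 'a"
  assumes f: "has_calc A f T" and g: "has_calc A g U"
  shows "has_calc A (\<lambda>t. f t * g t) (T o\<^sub>L U)"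
proof -
  obtain p q where p: "uniform_limit (real_spectrum A) (\<lambda>n. poly (p n)) f sequentially"
      "(\<lambda>n. op_poly (p n) A) \<longlonglongrightarrow> T"
    and q: "uniform_limit (real_spectrum A) (\<lambda>n. poly (q n)) g sequentially"
      "(\<lambda>n. op_poly (q n) A) \<longlonglongrightarrow> U"
    using assms unfolding has_calc_sequence by blast
  show ?thesis
    unfolding has_calc_sequence
    using uniform_lim_mult[OF p(1) q(1) has_calc_bounded[OF f] has_calc_bounded[OF g]]
      bounded_bilinear.tendsto[OF bounded_bilinear_blinfun_compose p(2) q(2)]
    by (intro exI[of _ "\<lambda>n. p n * q n"]) (simp add: op_poly_mult poly_mult_fun)
qed

lemma has_calc_cmult:
  fixes A :: "'a::{real_inner,banach} \<Rightarrow>\<^sub>L 'a"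
  assumes "has_calc A f T"
  shows "has_calc A (\<lambda>t. c * f t) (c *\<^sub>R T)"
  using has_calc_mult[OF has_calc_const assms, of c]
  by (simp add: blinfun_compose_id bounded_bilinear.scaleR_left[OF bounded_bilinear_blinfun_compose])

lemma has_calc_diff:
  fixes A :: "'a::{real_inner,banach} \<Rightarrow>\<^sub>L 'a"
  assumes "has_calc A f T" and "has_calc A g U"
  shows "has_calc A (\<lambda>t. f t - g t) (T - U)"
  using has_calc_add[OF assms(1) has_calc_cmult[OF assms(2), of "-1"]] by simp

lemma has_calc_symmetric:
  assumes "has_calc A f T" and "symmetric_op A"
  shows "symmetric_op T"
  unfolding symmetric_op_def
proof (intro allI)
  fix x y
  obtain p where p: "(\<lambda>n. op_poly (p n) A) \<longlonglongrightarrow> T"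
    using assms unfolding has_calc_sequence by blast
  have "(\<lambda>n. inner (op_poly (p n) A x) y) \<longlonglongrightarrow> inner (T x) y"
    by (intro tendsto_intros p)
  moreover have "(\<lambda>n. inner x (op_poly (p n) A y)) \<longlonglongrightarrow> inner x (T y)"
    by (intro tendsto_intros p)
  ultimately show "inner (T x) y = inner x (T y)"
    using symmetric_op_poly[OF assms(2)] LIMSEQ_unique unfolding symmetric_op_def by simp
qed

lemma has_calc_norm_le:
  fixes A :: "'a::{real_inner,banach} \<Rightarrow>\<^sub>L 'a"
  assumes "symmetric_op A" and "has_calc A f T" and "c \<ge> 0"
    and c: "\<And>t. t \<in> real_spectrum A \<Longrightarrow> \<bar>f t\<bar> \<le> c"
  shows "norm T \<le> c"
proof (rule field_le_epsilon)
  fix e :: real assume e: "e > 0"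
  obtain p where p: "\<And>t. t \<in> real_spectrum A \<Longrightarrow> \<bar>poly p t - f t\<bar> < e / 2" "norm (op_poly p A - T) < e / 2"
    using assms(2) e unfolding has_calc_def by (meson half_gt_zero)
  have "norm (op_poly p A) \<le> c + e / 2"
  proof (rule norm_op_poly_le[OF assms(1)])
    show "\<bar>poly p t\<bar> \<le> c + e / 2" if "t \<in> real_spectrum A" for t
      using p(1)[OF that] c[OF that] by linarith
  qed (use e \<open>c \<ge> 0\<close> in simp)
  moreover have "norm T \<le> norm (op_poly p A) + norm (op_poly p A - T)"
    by (metis norm_minus_commute norm_triangle_sub)
  ultimately show "norm T \<le> c + e" using p(2) by linarith
qed

text \<open>The operator \<open>T - U\<close> belongs to the zero function, so its norm is at most
  0.\<close>

lemma has_calc_unique: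
  fixes A :: "'a::{real_inner,banach} \<Rightarrow>\<^sub>L 'a"
  assumes "symmetric_op A" and "has_calc A f T" and "has_calc A f U"
  shows "T = U"
  using has_calc_norm_le[OF assms(1) has_calc_diff[OF assms(2,3)], of 0] by simp

text \<open>If \<open>0 \<le> f \<le> c\<close> on the spectrum, then \<open>c - f(A)\<close> has norm at most \<open>c\<close>.\<close>

lemma has_calc_nonneg:
  fixes A :: "'a::{real_inner,banach} \<Rightarrow>\<^sub>L 'a"
  assumes sym: "symmetric_op A" and T: "has_calc A f T"
    and f: "\<And>t. t \<in> real_spectrum A \<Longrightarrow> 0 \<le> f t"
  shows "0 \<le> inner (T x) x"
proof -
  obtain c where c: "c > 0" "\<And>t. t \<in> real_spectrum A \<Longrightarrow> \<bar>f t\<bar> \<le> c"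
    using has_calc_bounded[OF T] by (auto simp: bounded_pos)
  have "norm (c *\<^sub>R id_blinfun - T) \<le> c"
  proof (rule has_calc_norm_le[OF sym has_calc_diff[OF has_calc_const T]])
    show "\<bar>c - f t\<bar> \<le> c" if "t \<in> real_spectrum A" for t
      using c(2)[OF that] f[OF that] by linarith
  qed (use c in simp)
  then have "norm (c *\<^sub>R id_blinfun - T) * (norm x)\<^sup>2 \<le> c * (norm x)\<^sup>2"
    by (intro mult_right_mono) auto
  then have "inner ((c *\<^sub>R id_blinfun - T) x) x \<le> c * (norm x)\<^sup>2"
    using inner_blinfun_le order_trans by blast
  then show ?thesis
    by (simp add: blinfun.diff_left blinfun.scaleR_left inner_diff_left dot_square_norm)
qed

lemma has_calc_mono:
  fixes A :: "'a::{real_inner,banach} \<Rightarrow>\<^sub>L 'a"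
  assumes "symmetric_op A" and "has_calc A f T" and "has_calc A g U"
    and "\<And>t. t \<in> real_spectrum A \<Longrightarrow> f t \<le> g t"
  shows "inner (T x) x \<le> inner (U x) x"
  using has_calc_nonneg[OF assms(1) has_calc_diff[OF assms(3,2)], of x] assms(4)
  by (simp add: blinfun.diff_left inner_diff_left)

lemma has_calc_ge:
  fixes A :: "'a::{real_inner,banach} \<Rightarrow>\<^sub>L 'a"
  assumes "symmetric_op A" and "has_calc A f T" and "\<And>t. t \<in> real_spectrum A \<Longrightarrow> a \<le> f t"
  shows "a * (norm x)\<^sup>2 \<le> inner (T x) x"
  using has_calc_mono[OF assms(1) has_calc_const assms(2,3), of x]
  by (simp add: blinfun.scaleR_left dot_square_norm)

lemma has_calc_le:
  fixes A :: "'a::{real_inner,banach} \<Rightarrow>\<^sub>L 'a"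
  assumes "symmetric_op A" and "has_calc A f T" and "\<And>t. t \<in> real_spectrum A \<Longrightarrow> f t \<le> b"
  shows "inner (T x) x \<le> b * (norm x)\<^sup>2"
  using has_calc_mono[OF assms(1,2) has_calc_const assms(3), of x]
  by (simp add: blinfun.scaleR_left dot_square_norm)

section \<open>Existence of the calculus for continuous functions, and composition\<close>

lemma Weierstrass_poly:
  fixes f :: "real \<Rightarrow> real"
  assumes "continuous_on {a..b} f" and "e > 0"
  shows "\<exists>p. \<forall>t\<in>{a..b}. \<bar>poly p t - f t\<bar> < e"
proof -
  have "\<exists>g. (\<exists>p. g = poly p) \<and> (\<forall>x\<in>{a..b}. \<bar>f x - g x\<bar> < e)"
  proof (rule Stone_Weierstrass_HOL)
    show "\<exists>p. (\<lambda>x. c) = poly p" for c :: real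
      by (intro exI[of _ "[:c:]"]) auto
    show "\<exists>p. (\<lambda>x. f x + g x) = poly p" if fg: "(\<exists>p. f = poly p) \<and> (\<exists>p. g = poly p)" for f g :: "real \<Rightarrow> real"
    proof -
      obtain p q where "f = poly p" "g = poly q" using fg by blast
      then show ?thesis by (intro exI[of _ "p + q"]) auto
    qed
    show "\<exists>p. (\<lambda>x. f x * g x) = poly p" if fg: "(\<exists>p. f = poly p) \<and> (\<exists>p. g = poly p)" for f g :: "real \<Rightarrow> real"
    proof -
      obtain p q where "f = poly p" "g = poly q" using fg by blast
      then show ?thesis by (intro exI[of _ "p * q"]) auto
    qed
    show "\<exists>f. (\<exists>p. f = poly p) \<and> f x \<noteq> f y" if "x \<in> {a..b} \<and> y \<in> {a..b} \<and> x \<noteq> y" for x y :: real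
      using that by (intro exI[of _ "poly [:0, 1:]"]) auto
  qed (use assms in \<open>auto intro!: continuous_intros\<close>)
  then obtain p where "\<And>t. t \<in> {a..b} \<Longrightarrow> \<bar>f t - poly p t\<bar> < e" by blast
  then show ?thesis by (intro exI[of _ p]) (simp add: abs_minus_commute)
qed

text \<open>By \<open>norm_op_poly_le\<close>, polynomials that converge uniformly to
  \<open>f\<close> on the interval give a Cauchy sequence of operators, which converges by
  completeness.\<close>

lemma has_calc_exists:
  fixes A :: "'a::{real_inner,banach} \<Rightarrow>\<^sub>L 'a"
  assumes sym: "symmetric_op A" and S: "real_spectrum A \<subseteq> {a..b}" and f: "continuous_on {a..b} f"
  shows "\<exists>T. has_calc A f T"
proof -
  have "\<exists>p. \<forall>t\<in>{a..b}. \<bar>poly p t - f t\<bar> < inverse (real (Suc n))" for n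
    using Weierstrass_poly[OF f] by simp
  then obtain p where p: "\<And>n t. t \<in> {a..b} \<Longrightarrow> \<bar>poly (p n) t - f t\<bar> < inverse (real (Suc n))"
    by metis
  have small: "\<exists>N. \<forall>n\<ge>N. inverse (real (Suc n)) < e" if "e > 0" for e
    using order_tendstoD(2)[OF LIMSEQ_inverse_real_of_nat that] by (simp add: eventually_sequentially)
  have "Cauchy (\<lambda>n. op_poly (p n) A)"
  proof (rule metric_CauchyI)
    fix e :: real assume e: "e > 0"
    obtain N where N: "\<And>n. n \<ge> N \<Longrightarrow> inverse (real (Suc n)) < e / 3"
      using small[of "e / 3"] e by auto
    have "dist (op_poly (p m) A) (op_poly (p n) A) < e" if "m \<ge> N" "n \<ge> N" for m n
    proof -
      have "norm (op_poly (p m - p n) A) \<le> 2 * e / 3"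
      proof (rule norm_op_poly_le[OF sym])
        show "\<bar>poly (p m - p n) t\<bar> \<le> 2 * e / 3" if "t \<in> real_spectrum A" for t
        proof -
          have "t \<in> {a..b}" using that S by blast
          from p[OF this, of m] p[OF this, of n] N[OF \<open>m \<ge> N\<close>] N[OF \<open>n \<ge> N\<close>]
          show ?thesis unfolding poly_diff by linarith
        qed
      qed (use e in simp)
      then show ?thesis using e by (simp add: dist_norm op_poly_diff)
    qed
    then show "\<exists>N. \<forall>m\<ge>N. \<forall>n\<ge>N. dist (op_poly (p m) A) (op_poly (p n) A) < e" by blast
  qed
  then obtain T where T: "(\<lambda>n. op_poly (p n) A) \<longlonglongrightarrow> T"
    using Cauchy_convergent convergent_def by blast
  have "uniform_limit (real_spectrum A) (\<lambda>n. poly (p n)) f sequentially"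
  proof (rule uniform_limitI)
    fix e :: real assume "e > 0"
    from order_tendstoD(2)[OF LIMSEQ_inverse_real_of_nat this]
    show "\<forall>\<^sub>F n in sequentially. \<forall>t\<in>real_spectrum A. dist (poly (p n) t) (f t) < e"
      by eventually_elim (use S in \<open>auto simp: dist_real_def simp del: of_nat_Suc intro: less_trans[OF p]\<close>)
  qed
  with T show ?thesis using has_calc_sequence by blast
qed

lemma has_calc_poly_compose:
  fixes A :: "'a::{real_inner,banach} \<Rightarrow>\<^sub>L 'a"
  assumes "has_calc A f T"
  shows "has_calc A (\<lambda>t. poly q (f t)) (op_poly q T)"
proof (induction q)
  case 0
  show ?case using has_calc_const[of A 0] by simp
next
  case (pCons a q)
  then show ?case
    using has_calc_add[OF has_calc_const has_calc_mult[OF assms pCons(2)], of a]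
    by (simp add: op_poly_pCons)
qed

text \<open>A polynomial \<open>q\<close> close to \<open>g\<close> on \<open>{a..b}\<close> is used
  twice: \<open>q(f)\<close> is close to the composite on the spectrum of \<open>A\<close>, and
  \<open>q(T)\<close> is close to \<open>U\<close> because the spectrum of \<open>T\<close> lies in
  \<open>{a..b}\<close>.\<close>

lemma has_calc_compose:
  fixes A :: "'a::{real_inner,banach} \<Rightarrow>\<^sub>L 'a"
  assumes sym: "symmetric_op A" and f: "has_calc A f T"
    and ab: "\<And>t. t \<in> real_spectrum A \<Longrightarrow> f t \<in> {a..b}"
    and g: "continuous_on {a..b} g" and U: "has_calc T g U"
  shows "has_calc A (\<lambda>t. g (f t)) U"
proof (rule has_calc_limit)
  fix e :: real assume e: "e > 0"
  obtain q where q: "\<And>t. t \<in> {a..b} \<Longrightarrow> \<bar>poly q t - g t\<bar> < e"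
    using Weierstrass_poly[OF g e] by blast
  have symT: "symmetric_op T"
    using has_calc_symmetric[OF f sym] .
  \<comment> \<open>The inclusion comes from the bounds on the quadratic form of \<open>T\<close>,
    which replace a spectral mapping theorem.\<close>
  have S: "real_spectrum T \<subseteq> {a..b}"
  proof
    fix s assume s: "s \<in> real_spectrum T"
    have "a * (norm x)\<^sup>2 \<le> inner (T x) x" "inner (T x) x \<le> b * (norm x)\<^sup>2" for x
      using has_calc_ge[OF sym f, of a x] has_calc_le[OF sym f, of b x] ab by auto
    then show "s \<in> {a..b}"
      using real_spectrum_ge[OF s] real_spectrum_le[OF s] by auto
  qed
  have "norm (op_poly q T - U) \<le> e"
  proof (rule has_calc_norm_le[OF symT has_calc_diff[OF has_calc_poly U]])
    show "\<bar>poly q t - g t\<bar> \<le> e" if "t \<in> real_spectrum T" for t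
      using q[of t] S that by force
  qed (use e in simp)
  moreover have "\<forall>t\<in>real_spectrum A. \<bar>poly q (f t) - g (f t)\<bar> \<le> e"
    using q ab by (simp add: less_imp_le)
  ultimately show "\<exists>h V. has_calc A h V \<and> (\<forall>t\<in>real_spectrum A. \<bar>h t - g (f t)\<bar> \<le> e) \<and> norm (V - U) \<le> e"
    using has_calc_poly_compose[OF f, of q] by blast
qed

subsection \<open>Real powers of positive definite operators\<close>

text \<open>Positive invertible operators expressed through the real inner product alone; complex
  linearity is tracked separately.\<close>

definition posdef_op :: "('a::real_inner \<Rightarrow>\<^sub>L 'a) \<Rightarrow> bool"
  where "posdef_op A \<longleftrightarrow> symmetric_op A \<and> coercive_op A"

lemma posdef_opI:
  assumes "symmetric_op A" and "a > 0" and "\<And>x. a * (norm x)\<^sup>2 \<le> inner (A x) x"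
  shows "posdef_op A"
  using assms unfolding posdef_op_def coercive_op_def by blast

lemma posdef_op_spectrum:
  fixes A :: "'a::{real_inner,banach} \<Rightarrow>\<^sub>L 'a"
  assumes "posdef_op A"
  obtains b M where "0 < b" and "real_spectrum A \<subseteq> {b..M}"
proof -
  obtain b where b: "b > 0" "\<And>x. b * (norm x)\<^sup>2 \<le> inner (A x) x"
    using assms unfolding posdef_op_def coercive_op_def by blast
  have "real_spectrum A \<subseteq> {b..norm A}"
    using real_spectrum_ge[OF _ b(2)] real_spectrum_norm[of A] by force
  with b(1) that show thesis by blast
qed

text \<open>The left inverse \<open>F\<close> bounds \<open>|x|\<close> by a multiple of
  \<open>|E x|\<close>, so coercivity of \<open>B\<close> at \<open>E x\<close> passes to
  \<open>x\<close> at the cost of a factor \<open>1/k\<close>.\<close>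

lemma posdef_op_conj:
  assumes "posdef_op B" and "symmetric_op E" and FE: "F o\<^sub>L E = id_blinfun"
  shows "posdef_op (E o\<^sub>L B o\<^sub>L E)"
proof -
  obtain b where b: "b > 0" "\<And>x. b * (norm x)\<^sup>2 \<le> inner (B x) x"
    using assms unfolding posdef_op_def coercive_op_def by blast
  define k where "k = (norm F + 1)\<^sup>2"
  have "norm F + 1 > 0" by (simp add: add_nonneg_pos)
  then have k: "k > 0" by (simp add: k_def)
  have "b / k * (norm x)\<^sup>2 \<le> inner ((E o\<^sub>L B o\<^sub>L E) x) x" for x
  proof -
    have "F (E x) = x"
      using FE by (metis blinfun_apply_blinfun_compose id_blinfun.rep_eq)
    then have "norm x \<le> norm F * norm (E x)"
      using norm_blinfun[of F "E x"] by simp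
    then have "norm x \<le> (norm F + 1) * norm (E x)"
      unfolding distrib_right using norm_ge_zero[of "E x"] by linarith
    then have "(norm x)\<^sup>2 \<le> k * (norm (E x))\<^sup>2"
      using power_mono[of "norm x" _ 2] by (force simp: k_def power_mult_distrib)
    then have "b / k * (norm x)\<^sup>2 \<le> b / k * (k * (norm (E x))\<^sup>2)"
      using b k by (intro mult_left_mono) auto
    also have "\<dots> = b * (norm (E x))\<^sup>2" using k by simp
    also have "\<dots> \<le> inner ((E o\<^sub>L B o\<^sub>L E) x) x"
      using b(2)[of "E x"] assms(2) by (simp add: symmetric_opD)
    finally show ?thesis .
  qed
  then show ?thesis
    using assms b k by (intro posdef_opI[of _ "b / k"]) (auto simp: posdef_op_def)
qed

lemma real_spectrum_eq: "{t. complex_of_real t \<in> spectrum A} = real_spectrum A"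
proof -
  have "scaleC_id (complex_of_real t) = (t *\<^sub>R id_blinfun :: 'a \<Rightarrow>\<^sub>L 'a)" for t
    by (rule blinfun_eqI) (simp add: scaleC_id.rep_eq blinfun.scaleR_left scaleR_scaleC)
  then show ?thesis by (simp add: spectrum_def real_spectrum_def)
qed

text \<open>Every admissible sequence ends up within \<open>2e/3\<close> of a fixed polynomial
  \<open>q(A)\<close> near \<open>T\<close>, so all of them converge to \<open>T\<close>. The
  existence of one such sequence makes the described operator unique.\<close>

lemma fun_calc_eqI:
  assumes sym: "symmetric_op A" and T: "has_calc A f T"
  shows "fun_calc f A = T"
  unfolding fun_calc_def real_spectrum_eq
proof (rule the_equality)
  show "\<forall>p. uniform_limit (real_spectrum A) (\<lambda>n. poly (p n)) f sequentially
      \<longrightarrow> (\<lambda>n. op_poly (p n) A) \<longlonglongrightarrow> T"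
  proof (intro allI impI tendstoI)
    fix p and e :: real
    assume p: "uniform_limit (real_spectrum A) (\<lambda>n. poly (p n)) f sequentially" and e: "e > 0"
    have e3: "e / 3 > 0" using e by simp
    obtain q where q: "\<And>t. t \<in> real_spectrum A \<Longrightarrow> \<bar>poly q t - f t\<bar> < e / 3" "norm (op_poly q A - T) < e / 3"
      using T e3 unfolding has_calc_def by meson
    from uniform_limitD[OF p e3]
    show "\<forall>\<^sub>F n in sequentially. dist (op_poly (p n) A) T < e"
    proof eventually_elim
      case (elim n)
      have "norm (op_poly (p n - q) A) \<le> 2 * e / 3"
      proof (rule norm_op_poly_le[OF sym])
        fix t assume t: "t \<in> real_spectrum A"
        with elim have "\<bar>poly (p n) t - f t\<bar> < e / 3" by (simp add: dist_real_def)
        with q(1)[OF t] show "\<bar>poly (p n - q) t\<bar> \<le> 2 * e / 3"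
          unfolding poly_diff by linarith
      qed (use e in simp)
      then show ?case
        using q(2) norm_triangle_ineq[of "op_poly (p n) A - op_poly q A" "op_poly q A - T"]
        by (simp add: dist_norm op_poly_diff)
    qed
  qed
next
  fix U
  assume U: "\<forall>p. uniform_limit (real_spectrum A) (\<lambda>n. poly (p n)) f sequentially
      \<longrightarrow> (\<lambda>n. op_poly (p n) A) \<longlonglongrightarrow> U"
  obtain p where "uniform_limit (real_spectrum A) (\<lambda>n. poly (p n)) f sequentially"
    "(\<lambda>n. op_poly (p n) A) \<longlonglongrightarrow> T"
    using T unfolding has_calc_sequence by blast
  with U show "U = T" using LIMSEQ_unique by blast
qed

lemma has_calc_op_powr:
  assumes A: "posdef_op A"
  shows "has_calc A (\<lambda>t. t powr r) (A powr\<^sub>o\<^sub>p r)"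
proof -
  obtain b M where b: "0 < b" "real_spectrum A \<subseteq> {b..M}"
    using posdef_op_spectrum[OF A] .
  have "continuous_on {b..M} (\<lambda>t. t powr r)"
    using b(1) by (intro continuous_intros) auto
  then obtain T where "has_calc A (\<lambda>t. t powr r) T"
    using has_calc_exists b A unfolding posdef_op_def by blast
  with fun_calc_eqI A show ?thesis unfolding op_powr_def posdef_op_def by metis
qed

lemma op_powr_eqI:
  assumes "posdef_op A" and "has_calc A (\<lambda>t. t powr r) T"
  shows "A powr\<^sub>o\<^sub>p r = T"
  using has_calc_unique[OF _ has_calc_op_powr[OF assms(1)] assms(2)] assms(1)
  by (simp add: posdef_op_def)

lemma posdef_op_spectrum_pos:
  fixes A :: "'a::{real_inner,banach} \<Rightarrow>\<^sub>L 'a"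
  shows "posdef_op A \<Longrightarrow> t \<in> real_spectrum A \<Longrightarrow> 0 < t"
  using posdef_op_spectrum[of A] by (metis atLeastAtMost_iff less_le_trans subsetD)

lemma op_powr_0: "posdef_op A \<Longrightarrow> A powr\<^sub>o\<^sub>p 0 = id_blinfun"
  by (rule op_powr_eqI, assumption, rule has_calc_cong[OF has_calc_const[of A 1, simplified]])
    (auto dest: posdef_op_spectrum_pos)

lemma op_powr_1: "posdef_op A \<Longrightarrow> A powr\<^sub>o\<^sub>p 1 = A"
  by (rule op_powr_eqI, assumption, rule has_calc_cong[OF has_calc_ident])
    (auto dest: posdef_op_spectrum_pos)

lemma op_powr_add:
  assumes "posdef_op A"
  shows "A powr\<^sub>o\<^sub>p r o\<^sub>L A powr\<^sub>o\<^sub>p s = A powr\<^sub>o\<^sub>p (r + s)"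
  using op_powr_eqI[OF assms, of "r + s"]
    has_calc_mult[OF has_calc_op_powr[OF assms, of r] has_calc_op_powr[OF assms, of s]]
  by (simp add: powr_add)

lemma op_powr_apply_add:
  assumes "posdef_op A"
  shows "(A powr\<^sub>o\<^sub>p r) ((A powr\<^sub>o\<^sub>p s) x) = (A powr\<^sub>o\<^sub>p (r + s)) x"
  by (simp flip: op_powr_add[OF assms])

lemma symmetric_op_powr: "posdef_op A \<Longrightarrow> symmetric_op (A powr\<^sub>o\<^sub>p r)"
  using has_calc_symmetric has_calc_op_powr posdef_op_def by blast

lemma has_calc_posdef:
  fixes A :: "'a::{real_inner,banach} \<Rightarrow>\<^sub>L 'a"
  assumes "symmetric_op A" and "has_calc A f T" and "0 < a"
    and "\<And>t. t \<in> real_spectrum A \<Longrightarrow> a \<le> f t"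
  shows "posdef_op T"
  using posdef_opI[OF has_calc_symmetric[OF assms(2,1)] assms(3) has_calc_ge[OF assms(1,2,4)]] .

lemma has_calc_powr:
  assumes A: "symmetric_op A" and T: "has_calc A f T" and "0 < a"
    and f: "\<And>t. t \<in> real_spectrum A \<Longrightarrow> f t \<in> {a..b}"
  shows "has_calc A (\<lambda>t. f t powr s) (T powr\<^sub>o\<^sub>p s)"
proof (rule has_calc_compose[OF A T f])
  show "has_calc T (\<lambda>t. t powr s) (T powr\<^sub>o\<^sub>p s)"
    by (rule has_calc_op_powr, rule has_calc_posdef[OF A T \<open>0 < a\<close>]) (use f in auto)
  show "continuous_on {a..b} (\<lambda>t. t powr s)"
    using \<open>0 < a\<close> by (intro continuous_intros) auto
qed

text \<open>Powers are monotone in the base, in a direction set by the sign of \<open>r\<close>, so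
  the endpoint values are bounds. The positive lower bound is what iterating powers through
  \<open>has_calc_powr\<close> requires.\<close>

lemma op_powr_spectrum_bounds:
  fixes A :: "'a::{real_inner,banach} \<Rightarrow>\<^sub>L 'a"
  assumes A: "posdef_op A"
  obtains a b where "0 < a" and "\<And>t. t \<in> real_spectrum A \<Longrightarrow> t powr r \<in> {a..b}"
proof -
  obtain b M where b: "0 < b" "real_spectrum A \<subseteq> {b..M}"
    using posdef_op_spectrum[OF A] .
  \<comment> \<open>For an empty spectrum \<open>M\<close> may lie below \<open>b\<close>; the
    maximum keeps the right endpoint positive.\<close>
  define m where "m = max b M"
  have m: "t powr r \<in> {min (b powr r) (m powr r)..max (b powr r) (m powr r)}"
    if "t \<in> real_spectrum A" for t
  proof -
    have t: "b \<le> t" "t \<le> m" using b that by (auto simp: m_def)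
    show ?thesis
    proof (cases "0 \<le> r")
      case True
      then show ?thesis
        using powr_mono2[of r b t] powr_mono2[of r t m] t b(1) by auto
    next
      case False
      then show ?thesis
        using powr_mono2'[of r b t] powr_mono2'[of r t m] t b(1) by auto
    qed
  qed
  have "0 < min (b powr r) (m powr r)" using b(1) by (simp add: m_def)
  then show thesis using that m by blast
qed

lemma posdef_op_powr:
  assumes A: "posdef_op A"
  shows "posdef_op (A powr\<^sub>o\<^sub>p r)"
proof -
  obtain a b where "0 < a" "\<And>t. t \<in> real_spectrum A \<Longrightarrow> t powr r \<in> {a..b}"
    using op_powr_spectrum_bounds[OF A, of r] by blast
  with A has_calc_posdef[OF _ has_calc_op_powr[OF A]] show ?thesis
    by (auto simp: posdef_op_def)
qed

lemma inner_op_powr_nonneg: "posdef_op A \<Longrightarrow> 0 \<le> inner ((A powr\<^sub>o\<^sub>p r) x) x"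
  by (rule has_calc_nonneg[OF _ has_calc_op_powr]) (auto simp: posdef_op_def)

lemma op_powr_powr:
  assumes A: "posdef_op A"
  shows "(A powr\<^sub>o\<^sub>p r) powr\<^sub>o\<^sub>p s = A powr\<^sub>o\<^sub>p (r * s)"
proof -
  obtain a b where ab: "0 < a" "\<And>t. t \<in> real_spectrum A \<Longrightarrow> t powr r \<in> {a..b}"
    using op_powr_spectrum_bounds[OF A, of r] by blast
  have "has_calc A (\<lambda>t. (t powr r) powr s) ((A powr\<^sub>o\<^sub>p r) powr\<^sub>o\<^sub>p s)"
    using A has_calc_powr[OF _ has_calc_op_powr[OF A] ab] by (simp add: posdef_op_def)
  then show ?thesis
    using op_powr_eqI[OF A, of "r * s"] by (simp add: powr_powr)
qed

lemma posdef_op_scaleR: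
  fixes A :: "'a::{real_inner,banach} \<Rightarrow>\<^sub>L 'a"
  assumes A: "posdef_op A" and c: "c > 0"
  shows "posdef_op (c *\<^sub>R A)"
proof -
  obtain b M where b: "0 < b" "real_spectrum A \<subseteq> {b..M}"
    using posdef_op_spectrum[OF A] .
  show ?thesis
    by (rule has_calc_posdef[OF _ has_calc_cmult[OF has_calc_ident], of A "c * b"])
      (use A b c in \<open>auto simp: posdef_op_def\<close>)
qed

lemma op_powr_scaleR:
  assumes A: "posdef_op A" and c: "c > 0"
  shows "(c *\<^sub>R A) powr\<^sub>o\<^sub>p s = c powr s *\<^sub>R (A powr\<^sub>o\<^sub>p s)"
proof -
  have sym: "symmetric_op A" using A by (simp add: posdef_op_def)
  obtain b M where b: "0 < b" "real_spectrum A \<subseteq> {b..M}"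
    using posdef_op_spectrum[OF A] .
  have "has_calc A (\<lambda>t. (c * t) powr s) ((c *\<^sub>R A) powr\<^sub>o\<^sub>p s)"
    by (rule has_calc_powr[OF sym has_calc_cmult[OF has_calc_ident], of "c * b" _ "c * M"])
      (use b c in auto)
  then have "has_calc A (\<lambda>t. c powr s * t powr s) ((c *\<^sub>R A) powr\<^sub>o\<^sub>p s)"
    by (rule has_calc_cong) (use posdef_op_spectrum_pos[OF A] c in \<open>simp add: powr_mult\<close>)
  then show ?thesis
    using has_calc_unique[OF sym] has_calc_cmult[OF has_calc_op_powr[OF A]] by blast
qed

text \<open>The map \<open>(s, t)\<close> to \<open>t powr s\<close> is uniformly continuous on a
  compact rectangle away from \<open>t = 0\<close>, so nearby exponents give uniformly close
  functions on the spectrum.\<close>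

lemma tendsto_op_powr:
  assumes A: "posdef_op A" and s: "s \<longlonglongrightarrow> r"
  shows "(\<lambda>n. A powr\<^sub>o\<^sub>p (s n)) \<longlonglongrightarrow> A powr\<^sub>o\<^sub>p r"
proof (rule tendstoI)
  fix e :: real assume e: "e > 0"
  have sym: "symmetric_op A" using A by (simp add: posdef_op_def)
  obtain b M where b: "0 < b" "real_spectrum A \<subseteq> {b..M}"
    using posdef_op_spectrum[OF A] .
  let ?K = "{r - 1..r + 1} \<times> {b..M}"
  have "continuous_on ?K (\<lambda>z. snd z powr fst z)"
    using b(1) by (intro continuous_intros) auto
  then have "uniformly_continuous_on ?K (\<lambda>z. snd z powr fst z)"
    by (intro compact_uniformly_continuous compact_Times) auto
  then obtain d where d: "d > 0"
    "\<And>z w. z \<in> ?K \<Longrightarrow> w \<in> ?K \<Longrightarrow> dist w z < d \<Longrightarrow> dist (snd w powr fst w) (snd z powr fst z) < e / 2"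
    using e unfolding uniformly_continuous_on_def by (meson half_gt_zero)
  have "min d 1 > 0" using d by simp
  from tendstoD[OF s this] show "\<forall>\<^sub>F n in sequentially. dist (A powr\<^sub>o\<^sub>p s n) (A powr\<^sub>o\<^sub>p r) < e"
  proof eventually_elim
    case (elim n)
    have "norm (A powr\<^sub>o\<^sub>p s n - A powr\<^sub>o\<^sub>p r) \<le> e / 2"
    proof (rule has_calc_norm_le[OF sym has_calc_diff[OF has_calc_op_powr[OF A] has_calc_op_powr[OF A]]])
      fix t assume "t \<in> real_spectrum A"
      then have t: "t \<in> {b..M}" using b by blast
      have "\<bar>s n - r\<bar> < d" "\<bar>s n - r\<bar> < 1" using elim by (simp_all add: dist_real_def)
      then have "(s n, t) \<in> ?K" "(r, t) \<in> ?K" "dist (s n, t) (r, t) < d"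
        using t by (auto simp: dist_Pair_Pair dist_real_def)
      from d(2)[OF this(2,1,3)] show "\<bar>t powr s n - t powr r\<bar> \<le> e / 2"
        by (simp add: dist_real_def)
    qed (use e in simp)
    then show ?case using e by (simp add: dist_norm)
  qed
qed

subsection \<open>The Loewner-Heinz inequality\<close>

text \<open>The symmetric part of \<open>(Z + Y + s) (Z - Y + s)\<close> is \<open>(Z + s)\<^sup>2 - Y\<^sup>2 \<ge> s\<^sup>2\<close>, so \<open>Z - Y\<close>
  has no negative spectrum.\<close>

lemma inner_le_of_norm_le:
  fixes Y Z :: "'a::{real_inner,banach} \<Rightarrow>\<^sub>L 'a"
  assumes Y: "symmetric_op Y" and Z: "symmetric_op Z" and Zpos: "\<And>x. 0 \<le> inner (Z x) x"
    and le: "\<And>x. norm (Y x) \<le> norm (Z x)"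
  shows "inner (Y x) x \<le> inner (Z x) x"
proof -
  have "0 \<le> t" if t: "t \<in> real_spectrum (Z - Y)" for t
  proof (rule ccontr)
    assume "\<not> 0 \<le> t"
    define s where "s = - t"
    have s: "s > 0" using \<open>\<not> 0 \<le> t\<close> by (simp add: s_def)
    define W where "W = Z - Y - t *\<^sub>R id_blinfun"
    define k where "k = norm (Z + Y + s *\<^sub>R id_blinfun) + 1"
    have k: "k > 0" by (simp add: k_def add_nonneg_pos)
    have "s\<^sup>2 / k * norm x \<le> norm (W x)" for x
    proof -
      let ?z = "Z x + s *\<^sub>R x"
      have W: "W x = ?z - Y x"
        by (simp add: W_def s_def blinfun.diff_left blinfun.scaleR_left)
      have V: "(Z + Y + s *\<^sub>R id_blinfun) x = ?z + Y x"
        by (simp add: blinfun.add_left blinfun.scaleR_left)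
      have "(norm (Y x))\<^sup>2 \<le> (norm (Z x))\<^sup>2"
        using le by (intro power_mono) auto
      moreover have "(norm ?z)\<^sup>2 = (norm (Z x))\<^sup>2 + 2 * (s * inner (Z x) x) + s\<^sup>2 * (norm x)\<^sup>2"
        unfolding power2_norm_eq_inner
        by (simp add: inner_add_left inner_add_right inner_commute power2_eq_square)
      moreover have "0 \<le> s * inner (Z x) x" using Zpos[of x] s by simp
      ultimately have "s\<^sup>2 * (norm x)\<^sup>2 \<le> (norm ?z)\<^sup>2 - (norm (Y x))\<^sup>2" by linarith
      also have "\<dots> = inner (?z + Y x) (?z - Y x)"
        unfolding power2_norm_eq_inner inner_diff_right inner_add_left[of ?z "Y x"]
        by (simp add: inner_commute)
      also have "\<dots> \<le> norm (?z + Y x) * norm (W x)"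
        unfolding W by (rule norm_cauchy_schwarz)
      also have "\<dots> \<le> (k * norm x) * norm (W x)"
      proof (rule mult_right_mono)
        have "norm (?z + Y x) \<le> norm (Z + Y + s *\<^sub>R id_blinfun) * norm x"
          unfolding V[symmetric] by (rule norm_blinfun)
        then show "norm (?z + Y x) \<le> k * norm x"
          unfolding k_def distrib_right using norm_ge_zero[of x] by linarith
      qed simp
      finally have "norm x * (s\<^sup>2 * norm x) \<le> norm x * (k * norm (W x))"
        by (simp add: power2_eq_square mult_ac)
      then have "s\<^sup>2 * norm x \<le> k * norm (W x)"
        by (cases "x = 0") (use k in auto)
      then show ?thesis using k by (simp add: field_simps)
    qed
    moreover have "symmetric_op W" unfolding W_def using Y Z by auto
    moreover have "s\<^sup>2 / k > 0" using s k by simp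
    ultimately have "invertible_op W"
      using symmetric_op_bounded_below_invertible by blast
    then show False using t by (simp add: W_def real_spectrum_def)
  qed
  then have "0 \<le> inner ((Z - Y) x) x"
    using has_calc_nonneg[OF symmetric_op_diff[OF Z Y] has_calc_ident] by blast
  then show ?thesis by (simp add: blinfun.diff_left inner_diff_left)
qed

text \<open>A point outside \<open>Z\<close> would lie in a gap between a nearest point of
  \<open>Z\<close> on either side, and the midpoint of the gap would belong to
  \<open>Z\<close>.\<close>

lemma midpoint_closed_interval:
  fixes Z :: "real set"
  assumes Z: "closed Z" and mid: "\<And>u v. u \<in> Z \<Longrightarrow> v \<in> Z \<Longrightarrow> (u + v) / 2 \<in> Z"
    and a: "a \<in> Z" and b: "b \<in> Z"
  shows "{a..b} \<subseteq> Z"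
proof
  fix x assume x: "x \<in> {a..b}"
  show "x \<in> Z"
  proof (rule ccontr)
    assume xZ: "x \<notin> Z"
    define L where "L = Z \<inter> {a..x}"
    define R where "R = Z \<inter> {x..b}"
    have L: "Sup L \<in> L" "bdd_above L"
    proof -
      show "bdd_above L" by (simp add: L_def)
      then show "Sup L \<in> L"
        using a x Z by (intro closed_contains_Sup) (auto simp: L_def)
    qed
    have R: "Inf R \<in> R" "bdd_below R"
    proof -
      show "bdd_below R" by (simp add: R_def)
      then show "Inf R \<in> R"
        using b x Z by (intro closed_contains_Inf) (auto simp: R_def)
    qed
    have l: "Sup L \<in> Z" "Sup L < x" "a \<le> Sup L" and r: "Inf R \<in> Z" "x < Inf R" "Inf R \<le> b"
      using L(1) R(1) xZ unfolding L_def R_def by (auto simp: less_le)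
    define m where "m = (Sup L + Inf R) / 2"
    have m: "m \<in> Z" "Sup L < m" "m < Inf R"
      using mid[OF l(1) r(1)] l r by (auto simp: m_def)
    show False
    proof (cases "m \<le> x")
      case True
      then have "m \<in> L" using m l x by (auto simp: L_def)
      then show False using cSup_upper[OF _ L(2)] m by fastforce
    next
      case False
      then have "m \<in> R" using m r x by (auto simp: R_def)
      then show False using cInf_lower[OF _ R(2)] m by fastforce
    qed
  qed
qed

text \<open>With \<open>E = D\<^bsup>-u/2\<^esup>\<close>, \<open>Y = E C\<^bsup>(u+v)/2\<^esup> E\<close> and \<open>Z = D\<^bsup>(v-u)/2\<^esup>\<close>, splitting
  \<open>C\<^bsup>(u+v)/2\<^esup> = C\<^bsup>u/2\<^esup> C\<^bsup>v/2\<^esup>\<close> and using both hypotheses gives \<open>Y\<^sup>2 \<le> Z\<^sup>2\<close>, hence \<open>Y \<le> Z\<close>.\<close>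

lemma op_powr_mono_midpoint:
  assumes C: "posdef_op C" and D: "posdef_op D"
    and u: "\<And>x. inner ((C powr\<^sub>o\<^sub>p u) x) x \<le> inner ((D powr\<^sub>o\<^sub>p u) x) x"
    and v: "\<And>x. inner ((C powr\<^sub>o\<^sub>p v) x) x \<le> inner ((D powr\<^sub>o\<^sub>p v) x) x"
  shows "inner ((C powr\<^sub>o\<^sub>p ((u + v) / 2)) x) x \<le> inner ((D powr\<^sub>o\<^sub>p ((u + v) / 2)) x) x"
proof -
  have sq: "(norm ((A powr\<^sub>o\<^sub>p (r / 2)) x))\<^sup>2 = inner ((A powr\<^sub>o\<^sub>p r) x) x" if "posdef_op A" for A :: "'a \<Rightarrow>\<^sub>L 'a" and r x
    using symmetric_opD[OF symmetric_op_powr[OF that], of "r / 2" "(A powr\<^sub>o\<^sub>p (r / 2)) x" x]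
    by (simp add: power2_norm_eq_inner op_powr_apply_add[OF that])
  \<comment> \<open>Since half powers are symmetric, an inequality of quadratic forms for exponent
    \<open>r\<close> is a pointwise inequality of norms for exponent \<open>r/2\<close>.\<close>
  have half: "norm ((C powr\<^sub>o\<^sub>p (r / 2)) x) \<le> norm ((D powr\<^sub>o\<^sub>p (r / 2)) x)"
    if "\<And>x. inner ((C powr\<^sub>o\<^sub>p r) x) x \<le> inner ((D powr\<^sub>o\<^sub>p r) x) x" for r x
    by (rule power2_le_imp_le) (simp_all add: sq C D that)
  define E where "E = D powr\<^sub>o\<^sub>p (- u / 2)"
  define Y where "Y = E o\<^sub>L C powr\<^sub>o\<^sub>p ((u + v) / 2) o\<^sub>L E"
  define Z where "Z = D powr\<^sub>o\<^sub>p ((v - u) / 2)"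
  have symE: "symmetric_op E" unfolding E_def by (rule symmetric_op_powr[OF D])
  have "norm (Y w) \<le> norm (Z w)" for w
  proof -
    have "(norm (Y w))\<^sup>2 = inner ((C powr\<^sub>o\<^sub>p ((u + v) / 2)) (E w)) (E (Y w))"
      unfolding power2_norm_eq_inner by (simp add: Y_def symmetric_opD[OF symE])
    also have "(u + v) / 2 = u / 2 + v / 2" by (simp add: add_divide_distrib)
    also have "inner ((C powr\<^sub>o\<^sub>p (u / 2 + v / 2)) (E w)) (E (Y w)) =
        inner ((C powr\<^sub>o\<^sub>p (v / 2)) (E w)) ((C powr\<^sub>o\<^sub>p (u / 2)) (E (Y w)))"
      by (simp add: symmetric_opD[OF symmetric_op_powr[OF C]] flip: op_powr_apply_add[OF C])
    also have "\<dots> \<le> norm ((C powr\<^sub>o\<^sub>p (v / 2)) (E w)) * norm ((C powr\<^sub>o\<^sub>p (u / 2)) (E (Y w)))"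
      by (rule norm_cauchy_schwarz)
    also have "\<dots> \<le> norm ((D powr\<^sub>o\<^sub>p (v / 2)) (E w)) * norm ((D powr\<^sub>o\<^sub>p (u / 2)) (E (Y w)))"
      by (intro mult_mono half u v) auto
    \<comment> \<open>In front of \<open>E\<close>, the power \<open>v/2\<close> of \<open>D\<close>
      leaves \<open>Z\<close>, and the power \<open>u/2\<close> cancels \<open>E\<close>.\<close>
    also have "\<dots> = norm (Z w) * norm (Y w)"
      by (simp add: E_def Z_def op_powr_apply_add[OF D] op_powr_0[OF D] diff_divide_distrib)
    finally show ?thesis
      by (cases "Y w = 0") (auto simp: power2_eq_square)
  qed
  then have "inner (Y w) w \<le> inner (Z w) w" for w
    by (intro inner_le_of_norm_le)
      (auto simp: Y_def Z_def C D intro!: symE symmetric_op_powr inner_op_powr_nonneg)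
  \<comment> \<open>Evaluating at this vector undoes the conjugation by \<open>E\<close> and raises
    the exponent of \<open>Z\<close> to \<open>(u + v)/2\<close>.\<close>
  from this[of "(D powr\<^sub>o\<^sub>p (u / 2)) x"] show ?thesis
    using symmetric_opD[OF symE] symmetric_opD[OF symmetric_op_powr[OF D]]
    by (simp add: Y_def Z_def E_def op_powr_apply_add[OF D] op_powr_0[OF D] add_divide_distrib diff_divide_distrib add.commute)
qed

lemma Loewner_Heinz:
  assumes C: "posdef_op C" and D: "posdef_op D"
    and le: "\<And>x. inner (C x) x \<le> inner (D x) x" and r: "0 \<le> r" "r \<le> 1"
  shows "inner ((C powr\<^sub>o\<^sub>p r) x) x \<le> inner ((D powr\<^sub>o\<^sub>p r) x) x"
proof -
  define Z where "Z = {s. \<forall>x. inner ((C powr\<^sub>o\<^sub>p s) x) x \<le> inner ((D powr\<^sub>o\<^sub>p s) x) x}"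
  have "closed Z"
    unfolding closed_sequential_limits
  proof (intro allI impI, elim conjE)
    fix s l assume s: "\<forall>n. s n \<in> Z" and l: "s \<longlonglongrightarrow> l"
    have "inner ((C powr\<^sub>o\<^sub>p l) x) x \<le> inner ((D powr\<^sub>o\<^sub>p l) x) x" for x
    proof (rule LIMSEQ_le)
      show "(\<lambda>n. inner ((C powr\<^sub>o\<^sub>p s n) x) x) \<longlonglongrightarrow> inner ((C powr\<^sub>o\<^sub>p l) x) x"
        by (intro tendsto_intros tendsto_op_powr C l)
      show "(\<lambda>n. inner ((D powr\<^sub>o\<^sub>p s n) x) x) \<longlonglongrightarrow> inner ((D powr\<^sub>o\<^sub>p l) x) x"
        by (intro tendsto_intros tendsto_op_powr D l)
    qed (use s in \<open>auto simp: Z_def\<close>)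
    then show "l \<in> Z" by (simp add: Z_def)
  qed
  moreover have "0 \<in> Z" "1 \<in> Z"
    using C D le by (simp_all add: Z_def op_powr_0 op_powr_1)
  moreover have "(u + v) / 2 \<in> Z" if "u \<in> Z" "v \<in> Z" for u v
    using that op_powr_mono_midpoint[OF C D] unfolding Z_def by blast
  ultimately have "{0..1} \<subseteq> Z"
    by (intro midpoint_closed_interval)
  then show ?thesis using r by (auto simp: Z_def)
qed

subsection \<open>Complex linearity and the operator order\<close>

text \<open>With scalar multiplication written as the bounded operator \<open>scaleC_id c\<close>,
  its linearity and continuity become instances of the rules for bounded operators.\<close>

lemma complex_linear_iff: "complex_linear A \<longleftrightarrow> (\<forall>c x. A (scaleC_id c x) = scaleC_id c (A x))"
  by (simp add: complex_linear_def scaleC_id.rep_eq)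

lemma complex_linear_intros:
  shows complex_linear_0: "complex_linear 0"
    and complex_linear_id: "complex_linear id_blinfun"
    and complex_linear_add: "complex_linear A \<Longrightarrow> complex_linear B \<Longrightarrow> complex_linear (A + B)"
    and complex_linear_diff: "complex_linear A \<Longrightarrow> complex_linear B \<Longrightarrow> complex_linear (A - B)"
    and complex_linear_scaleR: "complex_linear A \<Longrightarrow> complex_linear (r *\<^sub>R A)"
    and complex_linear_compose: "complex_linear A \<Longrightarrow> complex_linear B \<Longrightarrow> complex_linear (A o\<^sub>L B)"
  by (simp_all add: complex_linear_iff blinfun.add_left blinfun.diff_left blinfun.scaleR_left
      blinfun.add_right blinfun.diff_right blinfun.scaleR_right)

lemma complex_linear_limit:
  assumes "\<And>n. complex_linear (X n)" and X: "X \<longlonglongrightarrow> A"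
  shows "complex_linear A"
  unfolding complex_linear_def
proof (intro allI)
  fix c x
  have "(\<lambda>n. X n (c *\<^sub>C x)) \<longlonglongrightarrow> A (c *\<^sub>C x)"
    by (intro tendsto_intros X)
  moreover have "(\<lambda>n. scaleC_id c (X n x)) \<longlonglongrightarrow> scaleC_id c (A x)"
    by (intro tendsto_intros X)
  ultimately show "A (c *\<^sub>C x) = c *\<^sub>C A x"
    using assms(1) LIMSEQ_unique unfolding complex_linear_def scaleC_id.rep_eq by simp
qed

lemma complex_linear_op_poly: "complex_linear A \<Longrightarrow> complex_linear (op_poly p A)"
  by (induction p) (auto simp: op_poly_pCons intro!: complex_linear_intros)

lemma complex_linear_op_powr:
  assumes "posdef_op A" and "complex_linear A"
  shows "complex_linear (A powr\<^sub>o\<^sub>p r)"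
proof -
  obtain p where "(\<lambda>n. op_poly (p n) A) \<longlonglongrightarrow> A powr\<^sub>o\<^sub>p r"
    using has_calc_op_powr[OF assms(1), of r] unfolding has_calc_sequence by blast
  then show ?thesis
    by (rule complex_linear_limit[OF complex_linear_op_poly[OF assms(2)]])
qed

lemma cinner_scaleC_right: "cinner x (c *\<^sub>C y) = cnj c * cinner x y"
  by (metis cinner_commute cinner_scaleC_left complex_cnj_mult)

lemma cinner_add_right: "cinner x (y + z) = cinner x y + cinner x z"
  by (metis cinner_commute cinner_add_left complex_cnj_add)

text \<open>Polarization: the imaginary part of \<open>\<langle>A (i x + y), i x + y\<rangle>\<close> is
  \<open>Re \<langle>A x, y\<rangle> - Re \<langle>A y, x\<rangle>\<close>.\<close>

lemma positive_op_symmetric: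
  assumes "positive_op A"
  shows "symmetric_op A"
  unfolding symmetric_op_def
proof (intro allI)
  fix x y
  have lin: "A (c *\<^sub>C x) = c *\<^sub>C A x" for c x
    using assms by (simp add: positive_op_def complex_linear_def)
  have im: "Im (cinner (A z) z) = 0" for z
    using assms by (auto simp: positive_op_def complex_nonneg_Reals_iff)
  have "Im (cinner (A (\<i> *\<^sub>C x + y)) (\<i> *\<^sub>C x + y)) = Re (cinner (A x) y) - Re (cinner (A y) x)"
    by (simp add: blinfun.add_right lin cinner_add_left cinner_add_right cinner_scaleC_left
        cinner_scaleC_right im)
  then show "inner (A x) y = inner x (A y)"
    unfolding im by (simp add: inner_eq_Re_cinner[of "A x"] inner_commute[of x] inner_eq_Re_cinner[of "A y"])
qed

lemma positive_op_inner_nonneg: "positive_op A \<Longrightarrow> 0 \<le> inner (A x) x"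
  by (simp add: positive_op_def inner_eq_Re_cinner complex_nonneg_Reals_iff)

text \<open>Symmetry for the real inner product, applied to \<open>i x\<close> and \<open>x\<close>,
  equates the imaginary part of \<open><A x, x>\<close> with its own negative.\<close>

lemma positive_opI:
  assumes "complex_linear A" and "symmetric_op A" and "\<And>x. 0 \<le> inner (A x) x"
  shows "positive_op A"
proof -
  have "Im (cinner (A x) x) = 0" for x
  proof -
    have "Re (cinner (A (\<i> *\<^sub>C x)) x) = Re (cinner (\<i> *\<^sub>C x) (A x))"
      using assms(2) by (simp add: symmetric_op_def flip: inner_eq_Re_cinner)
    moreover have "A (\<i> *\<^sub>C x) = \<i> *\<^sub>C A x"
      using assms(1) by (simp add: complex_linear_def)
    moreover have "cinner x (A x) = cnj (cinner (A x) x)"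
      by (rule cinner_commute)
    ultimately show ?thesis by (simp add: cinner_scaleC_left)
  qed
  then show ?thesis
    using assms by (simp add: positive_op_def complex_nonneg_Reals_iff flip: inner_eq_Re_cinner)
qed

lemma op_leI:
  assumes "complex_linear X" and "complex_linear Y" and "symmetric_op X" and "symmetric_op Y"
    and "\<And>x. inner (X x) x \<le> inner (Y x) x"
  shows "X \<le>\<^sub>o\<^sub>p Y"
  unfolding op_le_def
  by (rule positive_opI) (use assms in \<open>auto intro!: complex_linear_diff simp: blinfun.diff_left inner_diff_left\<close>)

lemma positive_op_posdef: "positive_op A \<Longrightarrow> invertible_op A \<Longrightarrow> posdef_op A"
  by (simp add: posdef_op_def positive_op_symmetric positive_op_inner_nonneg positive_invertible_coercive)

section \<open>Tsallis entropies and their operator bounds\<close>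

lemma tsallis_entropy_eq:
  assumes A: "posdef_op A"
  shows "tsallis_entropy lam A = (1 / lam) *\<^sub>R (A powr\<^sub>o\<^sub>p (1 - lam) - A)"
proof -
  \<comment> \<open>With \<open>B = I\<close> the middle factor is a power of \<open>A\<close>, and
    the exponents add up to \<open>1/2 - lam + 1/2 = 1 - lam\<close>.\<close>
  have "A powr\<^sub>o\<^sub>p (-1/2) o\<^sub>L id_blinfun o\<^sub>L A powr\<^sub>o\<^sub>p (-1/2) = A powr\<^sub>o\<^sub>p (-1)"
    using op_powr_add[OF A, of "-1/2" "-1/2"] by (simp add: blinfun_compose_id)
  then show ?thesis
    by (simp add: tsallis_entropy_def tsallis_relative_entropy_def op_powr_powr[OF A] op_powr_add[OF A])
qed

theorem proposition3p2:
  fixes A B :: "'a::complex_hilbert_space \<Rightarrow>\<^sub>L 'a" and lam :: real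
  assumes "\<exists>x::'a. x \<noteq> 0"
    and "0 < lam" and "lam \<le> 1"
    and "positive_op A" and "invertible_op A"
    and "positive_op B" and "invertible_op B"
  shows "tsallis_relative_entropy lam A B \<le>\<^sub>o\<^sub>p
           tsallis_entropy lam A + ln_tsallis lam (norm B) *\<^sub>R (A powr\<^sub>o\<^sub>p (1 - lam)) \<and>
         (\<forall>\<mu>::real. \<mu> > 0 \<and> \<mu> *\<^sub>R A \<le>\<^sub>o\<^sub>p B \<longrightarrow>
           ln_tsallis lam \<mu> *\<^sub>R A \<le>\<^sub>o\<^sub>p tsallis_relative_entropy lam A B)"
proof -
  have A: "posdef_op A" "complex_linear A" and B: "posdef_op B" "complex_linear B"
    using assms by (auto simp: positive_op_posdef positive_op_def)
  define R where "R = A powr\<^sub>o\<^sub>p (1/2)"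
  define E where "E = A powr\<^sub>o\<^sub>p (-1/2)"
  define C where "C = E o\<^sub>L B o\<^sub>L E"
  define G where "G = R o\<^sub>L C powr\<^sub>o\<^sub>p lam o\<^sub>L R"
  have T: "tsallis_relative_entropy lam A B = (1 / lam) *\<^sub>R (G - A)"
    by (simp add: tsallis_relative_entropy_def G_def C_def R_def E_def)
  have symA: "symmetric_op A" and symR: "symmetric_op R" and symE: "symmetric_op E"
    using A by (auto simp: R_def E_def posdef_op_def symmetric_op_powr)
  have clR: "complex_linear R" and clE: "complex_linear E"
    using A by (auto simp: R_def E_def complex_linear_op_powr)
  have "R o\<^sub>L E = id_blinfun"
    using op_powr_add[OF A(1)] op_powr_0[OF A(1)] by (simp add: R_def E_def)
  from posdef_op_conj[OF B(1) symE this] have C: "posdef_op C" "complex_linear C"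
    unfolding C_def by (auto intro: complex_linear_compose clE B)
  have ER: "E (R x) = x" for x
    using op_powr_0[OF A(1)] by (simp add: R_def E_def op_powr_apply_add[OF A(1)])
  have EE: "inner (E x) (E x) = inner ((A powr\<^sub>o\<^sub>p (-1)) x) x" for x
    using symmetric_opD[OF symE, of "E x" x] by (simp add: E_def op_powr_apply_add[OF A(1)])
  have RR: "inner (R x) (R x) = inner (A x) x" for x
    using symmetric_opD[OF symR, of "R x" x] op_powr_1[OF A(1)]
    by (simp add: R_def op_powr_apply_add[OF A(1)])
  have innerC: "inner (C x) x = inner (B (E x)) (E x)" for x
    using symE by (simp add: C_def symmetric_opD)
  have innerG: "inner (G x) x = inner ((C powr\<^sub>o\<^sub>p lam) (R x)) (R x)" for x
    using symR by (simp add: G_def symmetric_opD)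
  have G: "symmetric_op G" "complex_linear G"
    unfolding G_def
    by (auto intro!: symmetric_op_conj symR symmetric_op_powr C complex_linear_compose clR complex_linear_op_powr)
  have symT: "symmetric_op ((1 / lam) *\<^sub>R (G - A))" and clT: "complex_linear ((1 / lam) *\<^sub>R (G - A))"
    using G A symA by (auto intro!: complex_linear_diff complex_linear_scaleR)
  define n where "n = norm B"
  \<comment> \<open>This uses a nonzero vector: on a nonzero space an invertible operator has
    positive norm, so \<open>n\<close> may scale a positive definite operator.\<close>
  have "B \<noteq> 0"
    using assms(1) invertible_op_bounded_below[OF assms(7)] by fastforce
  then have n: "n > 0" by (simp add: n_def)
  define P where "P = A powr\<^sub>o\<^sub>p (1 - lam)"
  define D where "D = n *\<^sub>R (A powr\<^sub>o\<^sub>p (-1))"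
  have D: "posdef_op D"
    unfolding D_def by (intro posdef_op_scaleR posdef_op_powr A n)
  have Dlam: "D powr\<^sub>o\<^sub>p lam = n powr lam *\<^sub>R (A powr\<^sub>o\<^sub>p (- lam))"
    using op_powr_scaleR[OF posdef_op_powr[OF A(1)] n] op_powr_powr[OF A(1)] by (simp add: D_def)
  \<comment> \<open>This is \<open>B \<le> n\<close> evaluated at \<open>E x\<close>, where
    \<open>E^2\<close> is the inverse of \<open>A\<close>.\<close>
  have "inner (C x) x \<le> inner (D x) x" for x
    using inner_blinfun_le[of B "E x"]
    by (simp add: innerC D_def n_def blinfun.scaleR_left power2_norm_eq_inner EE)
  then have CD: "inner ((C powr\<^sub>o\<^sub>p lam) x) x \<le> inner ((D powr\<^sub>o\<^sub>p lam) x) x" for x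
    using Loewner_Heinz[OF C(1) D] assms by simp
  have GP: "inner (G x) x \<le> n powr lam * inner (P x) x" for x
  proof -
    have "inner ((A powr\<^sub>o\<^sub>p (- lam)) (R x)) (R x) = inner (P x) x"
      using symmetric_opD[OF symR, of "(A powr\<^sub>o\<^sub>p (- lam)) (R x)" x]
      by (simp add: R_def P_def op_powr_apply_add[OF A(1)])
    then show ?thesis
      using CD[of "R x"] by (simp add: innerG Dlam blinfun.scaleR_left)
  qed
  \<comment> \<open>The multiples of \<open>P\<close> on the right combine to
    \<open>n powr lam / lam\<close>, so the claim is \<open>GP\<close> divided by \<open>lam\<close>
    after removing \<open>A\<close>.\<close>
  have "(1 / lam) *\<^sub>R (G - A) \<le>\<^sub>o\<^sub>p (1 / lam) *\<^sub>R (P - A) + ln_tsallis lam n *\<^sub>R P"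
  proof (rule op_leI[OF clT _ symT])
    show "complex_linear ((1 / lam) *\<^sub>R (P - A) + ln_tsallis lam n *\<^sub>R P)"
      by (auto simp: P_def intro!: complex_linear_intros complex_linear_op_powr A)
    show "symmetric_op ((1 / lam) *\<^sub>R (P - A) + ln_tsallis lam n *\<^sub>R P)"
      by (auto simp: P_def intro!: symmetric_op_powr A symA)
    show "inner (((1 / lam) *\<^sub>R (G - A)) x) x \<le> inner (((1 / lam) *\<^sub>R (P - A) + ln_tsallis lam n *\<^sub>R P) x) x" for x
      using GP[of x] assms(2)
      by (simp add: ln_tsallis_def blinfun.add_left blinfun.diff_left blinfun.scaleR_left
          inner_add_left inner_diff_left field_simps)
  qed
  moreover have "ln_tsallis lam \<mu> *\<^sub>R A \<le>\<^sub>o\<^sub>p (1 / lam) *\<^sub>R (G - A)"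
    if \<mu>: "\<mu> > 0" "\<mu> *\<^sub>R A \<le>\<^sub>o\<^sub>p B" for \<mu>
  proof (rule op_leI[OF _ clT _ symT])
    have le: "\<mu> * inner (A x) x \<le> inner (B x) x" for x
      using positive_op_inner_nonneg[of "B - \<mu> *\<^sub>R A" x] \<mu>(2)
      by (simp add: op_le_def blinfun.diff_left blinfun.scaleR_left inner_diff_left)
    \<comment> \<open>Conjugation by \<open>E\<close> sends \<open>A\<close> to the identity, so
      \<open>\<mu> A \<le> B\<close> becomes \<open>\<mu> \<le> C\<close>.\<close>
    have C_ge: "\<mu> * (norm x)\<^sup>2 \<le> inner (C x) x" for x
    proof -
      have "inner (A (E x)) (E x) = (norm x)\<^sup>2"
        using RR[of "E x"] \<open>R o\<^sub>L E = id_blinfun\<close>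
        by (metis blinfun_apply_blinfun_compose id_blinfun.rep_eq power2_norm_eq_inner)
      then show ?thesis using le[of "E x"] by (simp add: innerC)
    qed
    \<comment> \<open>The lower bound is a scalar: it confines the spectrum of \<open>C\<close> to
      values at least \<open>\<mu>\<close>, where monotonicity of the real function
      \<open>t powr lam\<close> suffices.\<close>
    have "\<mu> powr lam * (norm x)\<^sup>2 \<le> inner ((C powr\<^sub>o\<^sub>p lam) x) x" for x
    proof (rule has_calc_ge[OF _ has_calc_op_powr[OF C(1)]])
      show "\<mu> powr lam \<le> t powr lam" if "t \<in> real_spectrum C" for t
        using real_spectrum_ge[OF that C_ge] \<mu>(1) assms(2) by (intro powr_mono2) auto
    qed (use C in \<open>simp add: posdef_op_def\<close>)
    from this[of "R _"] have "\<mu> powr lam * inner (A x) x \<le> inner (G x) x" for x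
      by (simp add: innerG power2_norm_eq_inner RR)
    then show "inner ((ln_tsallis lam \<mu> *\<^sub>R A) x) x \<le> inner (((1 / lam) *\<^sub>R (G - A)) x) x" for x
      using assms(2)
      by (simp add: ln_tsallis_def blinfun.diff_left blinfun.scaleR_left inner_diff_left field_simps)
  qed (use A symA in \<open>auto intro: complex_linear_scaleR\<close>)
  ultimately show ?thesis
    unfolding T tsallis_entropy_eq[OF A(1)] P_def n_def by blast
qed

end
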